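(* Let $\Sigma=\{0,1,\dots,k-1\}$ with $k\ge 2$, and let $\alpha$ and $\beta$ be computable, positive probability measures on $\Sigma$. Then for every sequence $R\in\Sigma^\infty$ that is random with respect to $\alpha$, \[\dim^\beta(R)=\mathrm{Dim}^\beta(R)=\frac{\mathcal{H}(\alpha)}{\mathcal{H}(\alpha)+\mathcal{D}(\alpha\|\beta)}.\]
   Context: A probability measure $\alpha$ on $\Sigma$ is a function $\alpha:\Sigma\to[0,1]$ with $\sum_a\alpha(a)=1$; it is positive if $\alpha(a)>0$ for all $a$, and computable if each $\alpha(a)$ is a computable real. It is extended to strings by $\alpha(w)=\prod_{i=0}^{|w|-1}\alpha(w[i])$. For $s\ge 0$, an $s$-$\beta$-gale is a function $d:\Sigma^*\to[0,\infty)$ with $d(w)=\sum_{a\in\Sigma}d(wa)\beta(a)^s$ for all $w$; a $1$-$\alpha$-gale is an $\alpha$-martingale. A function $f:\Sigma^*\to\mathbb{R}$ is constructive (lower semicomputable) if there is a computable rational-valued $\hat f(w,t)$, nondecreasing in $t$, with $\hat f(w,t)<f(w)$ and $\lim_t\hat f(w,t)=f(w)$. A gale $d$ succeeds on $S$ if $\limsup_{n\to\infty}d(S[0..n-1])=\infty$ and succeeds strongly if $\liminf_{n\to\infty}d(S[0..n-1])=\infty$. $R$ is $\alpha$-random if no constructive $\alpha$-martingale succeeds on $R$. $\dim^\beta(S)$ is the infimum of all $s\ge0$ such that some constructive $s$-$\beta$-gale succeeds on $S$, and $\mathrm{Dim}^\beta(S)$ is the infimum of all $s\ge 0$ such that some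 constructive $s$-$\beta$-gale succeeds strongly on $S$. $\mathcal{H}(\alpha)=\sum_a\alpha(a)\log\frac1{\alpha(a)}$ (Shannon entropy) and $\mathcal{D}(\alpha\|\beta)=\sum_a\alpha(a)\log\frac{\alpha(a)}{\beta(a)}$ (Kullback–Leibler divergence), logarithms base 2. *)

theory Defs
  imports Complex_Main "HOL-Library.Extended_Real" "HOL-Library.Liminf_Limsup"
    "HOL-Library.Nat_Bijection"
begin

(* Kleene's total (general) recursive functions: minimization is applied to regular functions only.
   A function of arity n acts on lists of length n; its values on other lists are irrelevant. *)
inductive recursive_fn :: "nat \<Rightarrow> (nat list \<Rightarrow> nat) \<Rightarrow> bool" where
  zero: "recursive_fn n (\<lambda>xs. 0)"
| succ: "recursive_fn 1 (\<lambda>xs. Suc (hd xs))"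
| proj: "i < n \<Longrightarrow> recursive_fn n (\<lambda>xs. xs ! i)"
| comp: "recursive_fn (length fs) g \<Longrightarrow> (\<And>f. f \<in> set fs \<Longrightarrow> recursive_fn n f)
    \<Longrightarrow> recursive_fn n (\<lambda>xs. g (map (\<lambda>f. f xs) fs))"
| prim_rec: "recursive_fn n f \<Longrightarrow> recursive_fn (Suc (Suc n)) g
    \<Longrightarrow> recursive_fn (Suc n)
          (\<lambda>xs. rec_nat (f (tl xs)) (\<lambda>y r. g (y # r # tl xs)) (hd xs))"
| minimize: "recursive_fn (Suc n) f \<Longrightarrow> (\<And>xs. length xs = n \<Longrightarrow> \<exists>y. f (y # xs) = 0)
    \<Longrightarrow> recursive_fn n (\<lambda>xs. LEAST y. f (y # xs) = 0)"

(* A rational is represented by naturals p, q, r as (p - q) / (r + 1). *)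
definition computable_rat_fn :: "nat \<Rightarrow> (nat list \<Rightarrow> rat) \<Rightarrow> bool" where
  "computable_rat_fn n f \<longleftrightarrow>
    (\<exists>p q r. recursive_fn n p \<and> recursive_fn n q \<and> recursive_fn n r \<and>
      (\<forall>xs. length xs = n \<longrightarrow>
         f xs = (of_nat (p xs) - of_nat (q xs)) / of_nat (Suc (r xs))))"

definition computable_real :: "real \<Rightarrow> bool" where
  "computable_real x \<longleftrightarrow>
    (\<exists>f. computable_rat_fn 1 f \<and> (\<forall>t::nat. \<bar>of_rat (f [t]) - x\<bar> \<le> 1 / 2 ^ t))"

(* The alphabet is {..<k}, so the set of strings is lists {..<k}; functions on symbols or strings
   are only constrained there. *)

definition prob_measure_on :: "nat \<Rightarrow> (nat \<Rightarrow> real) \<Rightarrow> bool" where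
  "prob_measure_on k \<alpha> \<longleftrightarrow> (\<forall>a<k. 0 \<le> \<alpha> a \<and> \<alpha> a \<le> 1) \<and> (\<Sum>a<k. \<alpha> a) = 1"

definition positive_measure :: "nat \<Rightarrow> (nat \<Rightarrow> real) \<Rightarrow> bool" where
  "positive_measure k \<alpha> \<longleftrightarrow> (\<forall>a<k. 0 < \<alpha> a)"

definition computable_measure :: "nat \<Rightarrow> (nat \<Rightarrow> real) \<Rightarrow> bool" where
  "computable_measure k \<alpha> \<longleftrightarrow> (\<forall>a<k. computable_real (\<alpha> a))"

(* Since 0 powr 0 = 0, the case s = 0 matches the usual convention only for positive \<beta>. *)
definition gale :: "nat \<Rightarrow> real \<Rightarrow> (nat \<Rightarrow> real) \<Rightarrow> (nat list \<Rightarrow> real) \<Rightarrow> bool" where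
  "gale k s \<beta> d \<longleftrightarrow>
    (\<forall>w \<in> lists {..<k}. 0 \<le> d w \<and> d w = (\<Sum>a<k. d (w @ [a]) * \<beta> a powr s))"

abbreviation martingale :: "nat \<Rightarrow> (nat \<Rightarrow> real) \<Rightarrow> (nat list \<Rightarrow> real) \<Rightarrow> bool" where
  "martingale k \<alpha> \<equiv> gale k 1 \<alpha>"

(* The approximation g depends on the string w (through its code) and on the stage t. *)
definition constructive :: "nat \<Rightarrow> (nat list \<Rightarrow> real) \<Rightarrow> bool" where
  "constructive k f \<longleftrightarrow>
    (\<exists>g. computable_rat_fn 2 g \<and>
      (\<forall>w \<in> lists {..<k}.
         mono (\<lambda>t. g [list_encode w, t]) \<and>
         (\<forall>t. of_rat (g [list_encode w, t]) < f w) \<and>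
         (\<lambda>t. of_rat (g [list_encode w, t])) \<longlonglongrightarrow> f w))"

definition succeeds :: "(nat list \<Rightarrow> real) \<Rightarrow> (nat \<Rightarrow> nat) \<Rightarrow> bool" where
  "succeeds d S \<longleftrightarrow> limsup (\<lambda>n. ereal (d (map S [0..<n]))) = \<infinity>"

definition succeeds_strongly :: "(nat list \<Rightarrow> real) \<Rightarrow> (nat \<Rightarrow> nat) \<Rightarrow> bool" where
  "succeeds_strongly d S \<longleftrightarrow> liminf (\<lambda>n. ereal (d (map S [0..<n]))) = \<infinity>"

definition random_wrt :: "nat \<Rightarrow> (nat \<Rightarrow> real) \<Rightarrow> (nat \<Rightarrow> nat) \<Rightarrow> bool" where
  "random_wrt k \<alpha> R \<longleftrightarrow> \<not> (\<exists>d. martingale k \<alpha> d \<and> constructive k d \<and> succeeds d R)"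

(* The infima are taken in ereal, where the infimum of the empty set is \<infinity>. *)
definition constructive_dim :: "nat \<Rightarrow> (nat \<Rightarrow> real) \<Rightarrow> (nat \<Rightarrow> nat) \<Rightarrow> ereal" where
  "constructive_dim k \<beta> S =
    Inf {ereal s | s. 0 \<le> s \<and> (\<exists>d. gale k s \<beta> d \<and> constructive k d \<and> succeeds d S)}"

definition constructive_strong_dim :: "nat \<Rightarrow> (nat \<Rightarrow> real) \<Rightarrow> (nat \<Rightarrow> nat) \<Rightarrow> ereal" where
  "constructive_strong_dim k \<beta> S =
    Inf {ereal s | s. 0 \<le> s \<and> (\<exists>d. gale k s \<beta> d \<and> constructive k d \<and> succeeds_strongly d S)}"

definition shannon_entropy :: "nat \<Rightarrow> (nat \<Rightarrow> real) \<Rightarrow> real" where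
  "shannon_entropy k \<alpha> = (\<Sum>a<k. \<alpha> a * log 2 (1 / \<alpha> a))"

definition kl_div :: "nat \<Rightarrow> (nat \<Rightarrow> real) \<Rightarrow> (nat \<Rightarrow> real) \<Rightarrow> real" where
  "kl_div k \<alpha> \<beta> = (\<Sum>a<k. \<alpha> a * log 2 (\<alpha> a / \<beta> a))"

end

(* Everything reduces to nonnegative lower semicomputable functions f whose alpha-average shrinks by
   a factor theta < 1 in every step. Such an f is dominated by the constructive alpha-martingale
   w |-> sum_v f(v) alpha(v | w), where alpha(v | w) is the conditional probability of the cylinder
   of v given that of w, so f is bounded along an alpha-random R.
   Applied to f(w) = prod_i c(w_i), with rationals c(a) slightly above exp(-l (x(a) - delta)), this
   gives sum_{i<n} x(R_i) --> infinity for each x with positive alpha-mean.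
   Upper bound: for s above the claimed value choose rationals r(a) slightly below
   alpha(a) / beta(a)^s; then prod_i r(w_i) tends to infinity along R and is a t-beta-gale, where
   t in [0, s] solves sum_a r(a) beta(a)^t = 1. As t need not be a computable real, no power of
   beta ever has to be computed.
   Lower bound: if an s-beta-gale d succeeds on R with s below the claimed value, multiply d(w) by
   prod_i c(w_i), with rationals c(a) slightly below beta(a)^s / alpha(a); the product is a
   function f as above that still succeeds on R. *)
theory Submission
  imports Defs
begin

section \<open>Recursive functions of list codes\<close>

text \<open>The values of a recursive function on lists of other lengths are junk, hence equality only at
    length n.\<close>

definition recursive :: "nat \<Rightarrow> (nat list \<Rightarrow> nat) \<Rightarrow> bool" where
  "recursive n f \<longleftrightarrow> (\<exists>f'. recursive_fn n f' \<and> (\<forall>xs. length xs = n \<longrightarrow> f xs = f' xs))"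

lemma recursive_cong: "recursive n f \<Longrightarrow> (\<And>xs. length xs = n \<Longrightarrow> f xs = g xs) \<Longrightarrow> recursive n g"
  unfolding recursive_def by auto

lemma recursive_of_recursive_fn: "recursive_fn n f \<Longrightarrow> recursive n f"
  unfolding recursive_def by blast

text \<open>The inner functions are replaced by members of \<open>recursive_fn\<close>, one chosen
  for each entry of \<open>fs\<close>. Junk values of \<open>g\<close> do no harm, since the list of
  results always has length \<open>length fs\<close>.\<close>

lemma recursive_comp:
  assumes "recursive (length fs) g" and "\<And>f. f \<in> set fs \<Longrightarrow> recursive n f"
  shows "recursive n (\<lambda>xs. g (map (\<lambda>f. f xs) fs))"
proof -
  obtain g' where g': "recursive_fn (length fs) g'" "\<And>ys. length ys = length fs \<Longrightarrow> g ys = g' ys"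
    using assms(1) unfolding recursive_def by blast
  have "\<forall>f\<in>set fs. \<exists>f'. recursive_fn n f' \<and> (\<forall>xs. length xs = n \<longrightarrow> f xs = f' xs)"
    using assms(2) unfolding recursive_def by blast
  from bchoice[OF this] obtain F where F: "\<And>f. f \<in> set fs \<Longrightarrow> recursive_fn n (F f)"
    "\<And>f xs. f \<in> set fs \<Longrightarrow> length xs = n \<Longrightarrow> f xs = F f xs"
    by blast
  have "recursive_fn n (\<lambda>xs. g' (map (\<lambda>f. f xs) (map F fs)))"
    using g' F by (intro recursive_fn.comp[of "map F fs" g' n]) auto
  moreover have "g (map (\<lambda>f. f xs) fs) = g' (map (\<lambda>f. f xs) (map F fs))" if "length xs = n" for xs
  proof -
    have "map (\<lambda>f. f xs) fs = map (\<lambda>f. f xs) (map F fs)"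
      using F(2) that by simp
    then show ?thesis using g'(2)[of "map (\<lambda>f. f xs) fs"] by (metis length_map)
  qed
  ultimately show ?thesis unfolding recursive_def by blast
qed

lemma recursive_nth: "i < n \<Longrightarrow> recursive n (\<lambda>xs. xs ! i)"
  by (intro recursive_of_recursive_fn recursive_fn.proj)

lemma recursive_comp1: "recursive 1 g \<Longrightarrow> recursive n f \<Longrightarrow> recursive n (\<lambda>xs. g [f xs])"
  using recursive_comp[of "[f]" g n] by simp

lemma recursive_comp2: "recursive 2 g \<Longrightarrow> recursive n f1 \<Longrightarrow> recursive n f2
    \<Longrightarrow> recursive n (\<lambda>xs. g [f1 xs, f2 xs])"
  using recursive_comp[of "[f1, f2]" g n] by (auto simp: numeral_2_eq_2)

lemma recursive_Suc: "recursive n f \<Longrightarrow> recursive n (\<lambda>xs. Suc (f xs))"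
  using recursive_comp1[OF recursive_of_recursive_fn[OF recursive_fn.succ]] by simp

lemma recursive_const: "recursive n (\<lambda>xs. c)"
  by (induction c) (auto intro: recursive_Suc recursive_of_recursive_fn recursive_fn.zero)

text \<open>\<open>prim_rec\<close> recurses on the first argument only. Composing with
  \<open>b\<close> followed by all projections lets the bound of a recursion be any recursive
  function of the parameters.\<close>

lemma recursive_subst_hd:
  assumes "recursive (Suc n) g" and "recursive n b"
  shows "recursive n (\<lambda>xs. g (b xs # xs))"
proof -
  let ?fs = "b # map (\<lambda>i xs. xs ! i) [0..<n]"
  have "recursive n (\<lambda>xs. g (map (\<lambda>f. f xs) ?fs))"
    using assms by (intro recursive_comp[of ?fs g n]) (auto intro: recursive_nth)
  then show ?thesis
    by (rule recursive_cong) (auto intro!: arg_cong[where f = g] nth_equalityI)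
qed

lemma recursive_rec_nat:
  assumes "recursive n f" and "recursive (Suc (Suc n)) (\<lambda>ys. G (hd ys) (hd (tl ys)) (tl (tl ys)))" and
      "recursive n b"
  shows "recursive n (\<lambda>xs. rec_nat (f xs) (\<lambda>y r. G y r xs) (b xs))"
proof -
  obtain f' where f': "recursive_fn n f'" "\<And>xs. length xs = n \<Longrightarrow> f xs = f' xs"
    using assms(1) unfolding recursive_def by blast
  obtain g' where g': "recursive_fn (Suc (Suc n)) g'"
    "\<And>xs. length xs = Suc (Suc n) \<Longrightarrow> G (hd xs) (hd (tl xs)) (tl (tl xs)) = g' xs"
    using assms(2) unfolding recursive_def by blast
  have "G y r xs = g' (y # r # xs)" if "length xs = n" for y r xs
    using g'(2)[of "y # r # xs"] that by simp
  then show ?thesis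
    using recursive_cong[OF recursive_subst_hd[OF recursive_of_recursive_fn[OF recursive_fn.prim_rec[OF
        f'(1) g'(1)]] assms(3)]] f'(2)
    by simp
qed

lemma recursive_hd: "0 < n \<Longrightarrow> recursive n (\<lambda>xs. hd xs)"
  by (rule recursive_cong[OF recursive_nth[of 0]]) (auto simp: hd_conv_nth)

lemma recursive_tl:
  assumes "recursive n f"
  shows "recursive (Suc n) (\<lambda>xs. f (tl xs))"
proof -
  let ?fs = "map (\<lambda>i xs. xs ! Suc i) [0..<n]"
  have "recursive (Suc n) (\<lambda>xs. f (map (\<lambda>f. f xs) ?fs))"
    using assms by (intro recursive_comp[of ?fs f "Suc n"]) (auto intro: recursive_nth)
  then show ?thesis
    by (rule recursive_cong) (auto intro!: arg_cong[where f = f] nth_equalityI simp: nth_tl)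
qed

lemma recursive_hd_tl: "1 < n \<Longrightarrow> recursive n (\<lambda>xs. hd (tl xs))"
  using recursive_tl[OF recursive_hd, of "n - 1"] by simp

text \<open>The step function of a recursion also receives the accumulator; this inserts that slot
  for a summand or factor that depends only on the counter and the parameters.\<close>

lemma recursive_skip:
  assumes "recursive (Suc n) (\<lambda>ys. F (hd ys) (tl ys))"
  shows "recursive (Suc (Suc n)) (\<lambda>ys. F (hd ys) (tl (tl ys)))"
proof -
  let ?fs = "hd # map (\<lambda>i xs. xs ! Suc (Suc i)) [0..<n]"
  have "recursive (Suc (Suc n)) (\<lambda>xs. (\<lambda>ys. F (hd ys) (tl ys)) (map (\<lambda>f. f xs) ?fs))"
    using assms by (intro recursive_comp[of ?fs "\<lambda>ys. F (hd ys) (tl ys)" "Suc (Suc n)"])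
        (auto intro: recursive_nth recursive_hd)
  then show ?thesis
    by (rule recursive_cong) (auto intro!: arg_cong[where f = "F _"] nth_equalityI simp: nth_tl)
qed

section \<open>Arithmetic by primitive recursion\<close>

lemma recursive_add: "recursive n f \<Longrightarrow> recursive n g \<Longrightarrow> recursive n (\<lambda>xs. f xs + g xs)"
proof -
  assume fg: "recursive n f" "recursive n g"
  have eq: "rec_nat a (\<lambda>y r. Suc r) b = a + b" for a b
    by (induction b) auto
  have "recursive n (\<lambda>xs. rec_nat (f xs) (\<lambda>y r. Suc r) (g xs))"
    by (rule recursive_rec_nat[OF fg(1) _ fg(2)]) (simp add: recursive_Suc recursive_hd_tl)
  then show ?thesis by (simp add: eq)
qed

lemma recursive_sum:
  assumes "recursive (Suc n) (\<lambda>ys. F (hd ys) (tl ys))" and "recursive n b"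
  shows "recursive n (\<lambda>xs. \<Sum>i<b xs. F i xs)"
proof -
  have eq: "rec_nat 0 (\<lambda>y r. r + F y xs) m = (\<Sum>i<m. F i xs)" for m xs
    by (induction m) auto
  have "recursive n (\<lambda>xs. rec_nat 0 (\<lambda>y r. r + F y xs) (b xs))"
    by (rule recursive_rec_nat[OF recursive_const _ assms(2)])
        (simp add: recursive_add recursive_hd_tl recursive_skip[OF assms(1)])
  then show ?thesis by (simp add: eq)
qed

lemma recursive_mult:
  assumes "recursive n f" "recursive n g" shows "recursive n (\<lambda>xs. f xs * g xs)"
proof -
  have "recursive n (\<lambda>xs. \<Sum>i<g xs. f xs)"
    by (rule recursive_sum[where F = "\<lambda>i. f", OF recursive_tl[OF assms(1)] assms(2)])
  then show ?thesis by (simp add: mult.commute)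
qed

lemma recursive_prod:
  assumes "recursive (Suc n) (\<lambda>ys. F (hd ys) (tl ys))" and "recursive n b"
  shows "recursive n (\<lambda>xs. \<Prod>i<b xs. F i xs)"
proof -
  have eq: "rec_nat 1 (\<lambda>y r. r * F y xs) m = (\<Prod>i<m. F i xs)" for m xs
    by (induction m) auto
  have "recursive n (\<lambda>xs. rec_nat 1 (\<lambda>y r. r * F y xs) (b xs))"
    by (rule recursive_rec_nat[OF recursive_const _ assms(2)])
        (simp add: recursive_mult recursive_hd_tl recursive_skip[OF assms(1)])
  then show ?thesis by (simp only: eq)
qed

lemma recursive_power:
  assumes "recursive n f" "recursive n g" shows "recursive n (\<lambda>xs. f xs ^ g xs)"
proof -
  have "recursive n (\<lambda>xs. \<Prod>i<g xs. f xs)"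
    by (rule recursive_prod[where F = "\<lambda>i. f", OF recursive_tl[OF assms(1)] assms(2)])
  then show ?thesis by simp
qed

lemma recursive_diff:
  assumes "recursive n f" "recursive n g" shows "recursive n (\<lambda>xs. f xs - g xs)"
proof -
  \<comment> \<open>A recursion that forgets the accumulator and returns the counter is the
    predecessor; iterating the predecessor gives truncated subtraction.\<close>
  have eq: "rec_nat 0 (\<lambda>y r. y) m = m - 1" for m
    by (cases m) auto
  have pred: "recursive m (\<lambda>xs. h xs - 1)" if "recursive m h" for m h
  proof -
    have "recursive m (\<lambda>xs. rec_nat 0 (\<lambda>y r. y) (h xs))"
      by (rule recursive_rec_nat[OF recursive_const _ that]) (intro recursive_hd zero_less_Suc)
    then show ?thesis by (simp only: eq)
  qed
  have eq2: "rec_nat a (\<lambda>y r. r - 1) b = a - b" for a b :: nat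
    by (induction b) auto
  have "recursive n (\<lambda>xs. rec_nat (f xs) (\<lambda>y r. r - 1) (g xs))"
    by (rule recursive_rec_nat[OF assms(1) _ assms(2)]) (intro pred recursive_hd_tl, simp)
  then show ?thesis by (simp only: eq2)
qed

section \<open>Decidable predicates as functions with values 0 and 1\<close>

abbreviation decidable :: "nat \<Rightarrow> (nat list \<Rightarrow> bool) \<Rightarrow> bool" where
  "decidable n P \<equiv> recursive n (\<lambda>xs. of_bool (P xs))"

lemma decidable_le: "recursive n f \<Longrightarrow> recursive n g \<Longrightarrow> decidable n (\<lambda>xs. f xs \<le> g xs)"
  by (rule recursive_cong[where f = "\<lambda>xs. 1 - (f xs - g xs)"])
      (intro recursive_diff recursive_const, auto)

lemma decidable_conj: "decidable n P \<Longrightarrow> decidable n Q \<Longrightarrow> decidable n (\<lambda>xs. P xs \<and> Q xs)"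
  by (rule recursive_cong[OF recursive_mult[of n "\<lambda>xs. of_bool (P xs)" "\<lambda>xs. of_bool (Q xs)"]]) auto

lemma decidable_less: "recursive n f \<Longrightarrow> recursive n g \<Longrightarrow> decidable n (\<lambda>xs. f xs < g xs)"
  using decidable_le[of n "\<lambda>xs. Suc (f xs)" g] by (simp add: recursive_Suc Suc_le_eq)

lemma decidable_eq: "recursive n f \<Longrightarrow> recursive n g \<Longrightarrow> decidable n (\<lambda>xs. f xs = g xs)"
  using decidable_conj[OF decidable_le[of n f g] decidable_le[of n g f]] by (simp add: eq_iff)

lemma decidable_all_less:
  assumes "decidable (Suc n) (\<lambda>ys. P (hd ys) (tl ys))" and "recursive n b"
  shows "decidable n (\<lambda>xs. \<forall>i<b xs. P i xs)"
proof -
  have eq: "(\<Prod>i<m. of_bool (P i xs)) = (of_bool (\<forall>i<m. P i xs) :: nat)" for m xs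
    by (induction m) (auto simp: less_Suc_eq)
  show ?thesis
    using recursive_prod[of n "\<lambda>i xs. of_bool (P i xs)" b] assms by (simp only: eq)
qed

lemma recursive_if:
  assumes "decidable n P" "recursive n f" "recursive n g"
  shows "recursive n (\<lambda>xs. if P xs then f xs else g xs)"
  by (rule recursive_cong[where f = "\<lambda>xs. of_bool (P xs) * f xs + (1 - of_bool (P xs)) * g xs"])
    (use assms in \<open>auto intro!: recursive_add recursive_mult recursive_diff recursive_const\<close>)

lemma recursive_min: "recursive n f \<Longrightarrow> recursive n g \<Longrightarrow> recursive n (\<lambda>xs. min (f xs) (g xs))"
  unfolding min_def by (intro recursive_if decidable_le)

text \<open>The quotient is the number of positive multiples of the divisor that do not exceed the
  dividend, so a bounded sum of indicators computes it.\<close>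

lemma recursive_div_Suc:
  assumes "recursive n f" "recursive n g"
  shows "recursive n (\<lambda>xs. f xs div Suc (g xs))"
proof -
  have eq: "(\<Sum>i<a. of_bool (Suc i * Suc b \<le> a)) = a div Suc b" for a b :: nat
  proof -
    have "(\<Sum>i<a. of_bool (Suc i * Suc b \<le> a)) = card ({..<a} \<inter> {i. Suc i * Suc b \<le> a})"
      by (simp add: of_bool_def sum.If_cases)
    also have "{..<a} \<inter> {i. Suc i * Suc b \<le> a} = {..<a div Suc b}"
      by (auto simp: less_eq_div_iff_mult_less_eq Suc_le_eq[symmetric] simp del: mult_Suc
          intro: order.trans[rotated])
    finally show ?thesis by simp
  qed
  have "recursive n (\<lambda>xs. \<Sum>i<f xs. of_bool (Suc i * Suc (g xs) \<le> f xs))"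
    by (intro recursive_sum decidable_le recursive_mult recursive_Suc recursive_hd recursive_tl[OF
        assms(1)] recursive_tl[OF assms(2)] assms zero_less_Suc)
  then show ?thesis by (simp only: eq)
qed

section \<open>Pairing and list codes\<close>

lemma recursive_prod_encode:
  assumes "recursive n f" "recursive n g"
  shows "recursive n (\<lambda>xs. prod_encode (f xs, g xs))"
proof -
  have eq: "(\<Sum>i<Suc m. i) = triangle m" for m
    by (induction m) auto
  have "recursive n (\<lambda>xs. (\<Sum>i<Suc (f xs + g xs). i) + f xs)"
    by (intro recursive_sum recursive_add recursive_Suc recursive_hd assms zero_less_Suc)
  then show ?thesis by (simp only: eq prod_encode_def prod.case)
qed

text \<open>Decoding by bounded search: both components are at most the code, and in the double sum
  over that square the indicator leaves only the summand at the decoded pair.\<close>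

lemma recursive_prod_decode:
  assumes "recursive n f"
  shows "recursive n (\<lambda>xs. fst (prod_decode (f xs)))" "recursive n (\<lambda>xs. snd (prod_decode (f xs)))"
proof -
  have eq: "(\<Sum>x<Suc z. \<Sum>y<Suc z. of_bool (prod_encode (x, y) = z) * h x y)
      = h (fst (prod_decode z)) (snd (prod_decode z))" for h :: "nat \<Rightarrow> nat \<Rightarrow> nat" and z
  proof -
    obtain a b where ab: "prod_decode z = (a, b)" by fastforce
    then have z: "prod_encode (a, b) = z"
      by (metis prod_decode_inverse)
    have le: "a < Suc z" "b < Suc z"
      using le_prod_encode_1[of a b] le_prod_encode_2[of b a] z by auto
    have "prod_encode (x, y) = z \<longleftrightarrow> x = a \<and> y = b" for x y
      using z by (metis prod_encode_eq prod.inject)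
    then have "(\<Sum>x<Suc z. \<Sum>y<Suc z. of_bool (prod_encode (x, y) = z) * h x y)
        = (\<Sum>x<Suc z. \<Sum>y<Suc z. if y = b then (if x = a then h x y else 0) else 0)"
      by (intro sum.cong) auto
    also have "\<dots> = h a b"
      using le by (simp add: sum.delta del: sum.lessThan_Suc)
    finally show ?thesis using ab by simp
  qed
  have "recursive n (\<lambda>xs. \<Sum>x<Suc (f xs). \<Sum>y<Suc (f xs). of_bool (prod_encode (x, y) = f xs) * x)"
    "recursive n (\<lambda>xs. \<Sum>x<Suc (f xs). \<Sum>y<Suc (f xs). of_bool (prod_encode (x, y) = f xs) * y)"
    by (intro recursive_sum recursive_mult decidable_eq recursive_prod_encode recursive_Suc recursive_hd
        recursive_hd_tl recursive_tl[OF assms] recursive_tl[OF recursive_tl[OF assms]]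
        assms zero_less_Suc | simp)+
  then show "recursive n (\<lambda>xs. fst (prod_decode (f xs)))" "recursive n (\<lambda>xs. snd (prod_decode (f xs)))"
    by (simp_all only: eq)
qed

text \<open>\<open>list_encode\<close> sends \<open>[]\<close> to 0 and a nonempty list to the
  successor of a pair code, so one step of the recursion passes to the code of the tail.\<close>

definition code_drop :: "nat \<Rightarrow> nat \<Rightarrow> nat" where
  "code_drop c i = rec_nat c (\<lambda>_ r. snd (prod_decode (r - 1))) i"

definition code_nth :: "nat \<Rightarrow> nat \<Rightarrow> nat" where
  "code_nth c i = fst (prod_decode (code_drop c i - 1))"

text \<open>Counts the nonempty suffixes. Stopping at \<open>c\<close> loses none of them, as a list
  is no longer than its code.\<close>

definition code_length :: "nat \<Rightarrow> nat" where
  "code_length c = (\<Sum>i<c. of_bool (0 < code_drop c i))"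

lemma code_drop_list_encode: "code_drop (list_encode w) i = list_encode (drop i w)"
proof (induction i)
  case 0
  then show ?case by (simp add: code_drop_def)
next
  case (Suc i)
  \<comment> \<open>Together with \<open>0 - 1 = 0\<close> on naturals this keeps the code 0 of
    \<open>[]\<close> fixed, so dropping past the end agrees with \<open>drop\<close>.\<close>
  have "prod_decode 0 = (0, 0)"
    using prod_encode_inverse[of "(0, 0)"] by (simp add: prod_encode_def)
  moreover have "list_encode (drop (Suc i) w) = snd (prod_decode (list_encode (drop i w) - 1))"
    using \<open>prod_decode 0 = (0, 0)\<close>
    by (cases "drop i w") (auto simp: drop_Suc drop_tl)
  ultimately show ?case
    using Suc by (simp add: code_drop_def)
qed

lemma code_nth_list_encode: "i < length w \<Longrightarrow> code_nth (list_encode w) i = w ! i"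
  by (cases "drop i w") (auto simp: code_nth_def code_drop_list_encode nth_via_drop)

lemma length_le_list_encode: "length w \<le> list_encode w"
proof (induction w)
  case (Cons a w)
  then show ?case using le_prod_encode_2[of "list_encode w" a] by simp
qed simp

lemma code_length_list_encode: "code_length (list_encode w) = length w"
proof -
  have "0 < list_encode (drop i w) \<longleftrightarrow> i < length w" for i
    by (cases "drop i w") (auto simp: leI, use not_less in fastforce)
  then have "code_length (list_encode w) = card ({..<list_encode w} \<inter> {i. i < length w})"
    unfolding code_length_def code_drop_list_encode by (simp add: of_bool_def sum.If_cases)
  also have "{..<list_encode w} \<inter> {i. i < length w} = {..<length w}"
    using length_le_list_encode[of w] by auto
  finally show ?thesis by simp
qed

lemma recursive_code_drop:
  assumes "recursive n f" "recursive n g" shows "recursive n (\<lambda>xs. code_drop (f xs) (g xs))"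
  unfolding code_drop_def
  by (rule recursive_rec_nat[OF assms(1) _ assms(2)])
      (intro recursive_prod_decode recursive_diff recursive_const recursive_hd_tl, simp)

lemma recursive_code_nth: "recursive n f \<Longrightarrow> recursive n g \<Longrightarrow> recursive n (\<lambda>xs. code_nth (f xs) (g xs))"
  unfolding code_nth_def by (intro recursive_prod_decode recursive_diff recursive_const
      recursive_code_drop)

lemma recursive_code_length:
  assumes "recursive n f" shows "recursive n (\<lambda>xs. code_length (f xs))"
  unfolding code_length_def
  by (intro recursive_sum decidable_less recursive_const recursive_code_drop recursive_tl[OF assms]
      recursive_hd zero_less_Suc assms)

section \<open>Lower semicomputable functions\<close>

text \<open>Unlike in \<open>computable_rat_fn\<close>, values are real and nonnegative: one
  numerator suffices, and no \<open>of_rat\<close> enters the limits.\<close>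

definition computable_nnrat :: "nat \<Rightarrow> (nat list \<Rightarrow> real) \<Rightarrow> bool" where
  "computable_nnrat n f \<longleftrightarrow> (\<exists>p r. recursive n p \<and> recursive n r \<and>
    (\<forall>xs. length xs = n \<longrightarrow> f xs = real (p xs) / real (Suc (r xs))))"

lemma computable_nnratI:
  assumes "recursive n p" "recursive n r" "\<And>xs. length xs = n \<Longrightarrow> f xs = real (p xs) / real (Suc (r xs))"
  shows "computable_nnrat n f"
  using assms unfolding computable_nnrat_def by blast

lemma computable_nnratE:
  assumes "computable_nnrat n f"
  obtains p r where "recursive n p" "recursive n r" "\<And>xs. length xs = n
      \<Longrightarrow> f xs = real (p xs) / real (Suc (r xs))"
  using assms unfolding computable_nnrat_def by blast

lemma computable_nnrat_nonneg: "computable_nnrat n f \<Longrightarrow> length xs = n \<Longrightarrow> 0 \<le> f xs"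
  by (elim computable_nnratE) simp

lemma computable_nnrat_cong: "computable_nnrat n f \<Longrightarrow> (\<And>xs. length xs = n \<Longrightarrow> f xs = g xs)
    \<Longrightarrow> computable_nnrat n g"
  unfolding computable_nnrat_def by auto

lemma computable_nnrat_const:
  assumes "c \<in> \<rat>" "0 \<le> c"
  shows "computable_nnrat n (\<lambda>xs. c)"
proof -
  obtain p q where "q \<noteq> 0" "\<bar>c\<bar> = real p / real q"
    using Rats_abs_nat_div_natE[OF assms(1)] by metis
  then show ?thesis
    using assms(2) by (intro computable_nnratI[of n "\<lambda>_. p" "\<lambda>_. q - 1"] recursive_const) auto
qed

lemma computable_nnrat_mult:
  assumes "computable_nnrat n f" "computable_nnrat n g"
  shows "computable_nnrat n (\<lambda>xs. f xs * g xs)"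
proof -
  obtain p r where f: "recursive n p" "recursive n r" "\<And>xs. length xs = n
      \<Longrightarrow> f xs = real (p xs) / real (Suc (r xs))"
    using assms(1) by (rule computable_nnratE) blast
  obtain p' r' where g: "recursive n p'" "recursive n r'" "\<And>xs. length xs = n
      \<Longrightarrow> g xs = real (p' xs) / real (Suc (r' xs))"
    using assms(2) by (rule computable_nnratE) blast
  \<comment> \<open>The \<open>- 1\<close> undoes the \<open>Suc\<close> that the representation
    puts on denominators; the product is positive, so nothing is truncated.\<close>
  show ?thesis
    by (rule computable_nnratI[of n "\<lambda>xs. p xs * p' xs" "\<lambda>xs. Suc (r xs) * Suc (r' xs) - 1"])
      (use f g in \<open>simp_all add: recursive_mult recursive_diff recursive_Suc recursive_const del:
          mult_Suc mult_Suc_right of_nat_Suc\<close>)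
qed

lemma computable_nnrat_if:
  assumes "decidable n P" "computable_nnrat n f" "computable_nnrat n g"
  shows "computable_nnrat n (\<lambda>xs. if P xs then f xs else g xs)"
proof -
  obtain p r where f: "recursive n p" "recursive n r" "\<And>xs. length xs = n
      \<Longrightarrow> f xs = real (p xs) / real (Suc (r xs))"
    using assms(2) by (rule computable_nnratE) blast
  obtain p' r' where g: "recursive n p'" "recursive n r'" "\<And>xs. length xs = n
      \<Longrightarrow> g xs = real (p' xs) / real (Suc (r' xs))"
    using assms(3) by (rule computable_nnratE) blast
  show ?thesis
    by (rule computable_nnratI[of n "\<lambda>xs. if P xs then p xs else p' xs" "\<lambda>xs.
        if P xs then r xs else r' xs"])
      (use assms(1) f g in \<open>simp_all add: recursive_if\<close>)
qed

lemma computable_nnrat_comp1: "computable_nnrat 1 h \<Longrightarrow> recursive n f \<Longrightarrow> computable_nnrat n (\<lambda>xs. h [f xs])"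
proof (elim computable_nnratE)
  fix p r
  assume "recursive n f" "recursive 1 p" "recursive 1 r" "\<And>xs. length xs = 1
      \<Longrightarrow> h xs = real (p xs) / real (Suc (r xs))"
  then show ?thesis
    by (intro computable_nnratI[of n "\<lambda>xs. p [f xs]" "\<lambda>xs. r [f xs]"]) (simp_all add: recursive_comp1)
qed

lemma computable_nnrat_comp2: "computable_nnrat 2 h \<Longrightarrow> recursive n f \<Longrightarrow> recursive n g
    \<Longrightarrow> computable_nnrat n (\<lambda>xs. h [f xs, g xs])"
proof (elim computable_nnratE)
  fix p r
  assume "recursive n f" "recursive n g" "recursive 2 p" "recursive 2 r" "\<And>xs. length xs = 2
      \<Longrightarrow> h xs = real (p xs) / real (Suc (r xs))"
  then show ?thesis
    by (intro computable_nnratI[of n "\<lambda>xs. p [f xs, g xs]" "\<lambda>xs. r [f xs, g xs]"])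
        (simp_all add: recursive_comp2)
qed

lemma recursive_hd_Cons_tl: "recursive (Suc n) p \<Longrightarrow> recursive (Suc n) (\<lambda>ys. p (hd ys # tl ys))"
  by (rule recursive_cong[of "Suc n" p]) (auto simp: length_Suc_conv)

lemma computable_nnrat_prod:
  assumes "computable_nnrat (Suc n) (\<lambda>ys. F (hd ys) (tl ys))" and "recursive n b"
  shows "computable_nnrat n (\<lambda>xs. \<Prod>i<b xs. F i xs)"
proof -
  obtain p r where F: "recursive (Suc n) p" "recursive (Suc n) r"
    "\<And>ys. length ys = Suc n \<Longrightarrow> F (hd ys) (tl ys) = real (p ys) / real (Suc (r ys))"
    using assms(1) by (rule computable_nnratE) blast
  have F': "F i xs = real (p (i # xs)) / real (Suc (r (i # xs)))" if "length xs = n" for i xs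
    using F(3)[of "i # xs"] that by simp
  have pos: "0 < (\<Prod>i<m. Suc (r (i # xs)))" for m xs
    by (simp add: prod_pos)
  show ?thesis
  proof (rule computable_nnratI)
    show "recursive n (\<lambda>xs. \<Prod>i<b xs. p (i # xs))"
      by (intro recursive_prod recursive_hd_Cons_tl F assms)
    show "recursive n (\<lambda>xs. (\<Prod>i<b xs. Suc (r (i # xs))) - 1)"
      by (intro recursive_diff recursive_const recursive_prod recursive_Suc recursive_hd_Cons_tl F assms)
    fix xs :: "nat list" assume "length xs = n"
    then show "(\<Prod>i<b xs. F i xs) =
        real (\<Prod>i<b xs. p (i # xs)) / real (Suc ((\<Prod>i<b xs. Suc (r (i # xs))) - 1))"
      using pos[of xs "b xs"] by (simp add: F' prod_dividef del: of_nat_Suc)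
  qed
qed

text \<open>All summands are brought to the common denominator \<open>D\<close>, the product of
  their denominators, which each of them divides.\<close>

lemma computable_nnrat_sum:
  assumes "computable_nnrat (Suc n) (\<lambda>ys. F (hd ys) (tl ys))" and "recursive n b"
  shows "computable_nnrat n (\<lambda>xs. \<Sum>i<b xs. F i xs)"
proof -
  obtain p r where F: "recursive (Suc n) p" "recursive (Suc n) r"
    "\<And>ys. length ys = Suc n \<Longrightarrow> F (hd ys) (tl ys) = real (p ys) / real (Suc (r ys))"
    using assms(1) by (rule computable_nnratE) blast
  have F': "F i xs = real (p (i # xs)) / real (Suc (r (i # xs)))" if "length xs = n" for i xs
    using F(3)[of "i # xs"] that by simp
  define D where "D xs = (\<Prod>i<b xs. Suc (r (i # xs)))" for xs
  have pos: "0 < D xs" for xs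
    by (simp add: D_def prod_pos)
  have D: "recursive n D"
    unfolding D_def by (intro recursive_prod recursive_Suc recursive_hd_Cons_tl F assms)
  show ?thesis
  proof (rule computable_nnratI)
    show "recursive n (\<lambda>xs. \<Sum>i<b xs. p (i # xs) * (D xs div Suc (r (i # xs))))"
      by (intro recursive_sum recursive_mult recursive_div_Suc recursive_tl[OF D] recursive_hd_Cons_tl F
          assms)
    show "recursive n (\<lambda>xs. D xs - 1)"
      by (intro recursive_diff recursive_const D)
    fix xs :: "nat list" assume xs: "length xs = n"
    have "F i xs = real (p (i # xs) * (D xs div Suc (r (i # xs)))) / real (D xs)" if "i < b xs" for i
    proof -
      have "Suc (r (i # xs)) dvd D xs"
        unfolding D_def using that by (intro dvd_prodI) auto
      then have "real (D xs div Suc (r (i # xs))) = real (D xs) / real (Suc (r (i # xs)))"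
        by (rule real_of_nat_div)
      then show ?thesis
        using pos[of xs] xs by (simp add: F' del: of_nat_Suc)
    qed
    then show "(\<Sum>i<b xs. F i xs) =
        real (\<Sum>i<b xs. p (i # xs) * (D xs div Suc (r (i # xs)))) / real (Suc (D xs - 1))"
      using pos[of xs] by (simp add: sum_divide_distrib del: of_nat_Suc)
  qed
qed

text \<open>Each \<open>F b\<close> may have its own unrelated algorithm; as \<open>k\<close> is
  fixed, nested case distinctions combine them. This handles data given separately for each
  symbol.\<close>

lemma computable_nnrat_case_less:
  assumes "\<And>b. b < k \<Longrightarrow> computable_nnrat n (F b)" and "recursive n e"
  shows "computable_nnrat n (\<lambda>xs. if e xs < k then F (e xs) xs else 0)"
  using assms(1)
proof (induction k)
  case 0
  then show ?case by (simp add: computable_nnrat_const)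
next
  case (Suc k)
  have "computable_nnrat n (\<lambda>xs. if e xs = k then F k xs else if e xs < k then F (e xs) xs else 0)"
    by (intro computable_nnrat_if decidable_eq recursive_const assms(2) Suc) auto
  then show ?case
    by (rule computable_nnrat_cong) auto
qed

text \<open>A variant of \<open>constructive\<close> for nonnegative functions: the approximations
  are nonnegative and may attain the limit, which makes it easy to form products and series.\<close>

definition lower_semicomputable :: "nat \<Rightarrow> (nat list \<Rightarrow> real) \<Rightarrow> bool" where
  "lower_semicomputable k f \<longleftrightarrow> (\<exists>h. computable_nnrat 2 h \<and> (\<forall>w \<in> lists {..<k}.
     incseq (\<lambda>t. h [list_encode w, t]) \<and> (\<lambda>t. h [list_encode w, t]) \<longlonglongrightarrow> f w))"

text \<open>Subtracting \<open>1 / Suc t\<close> at stage \<open>t\<close> makes every approximation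
  strictly smaller than the limit and preserves monotonicity and convergence.\<close>

lemma lower_semicomputable_imp_constructive:
  assumes "lower_semicomputable k f"
  shows "constructive k f"
proof -
  obtain h where h: "computable_nnrat 2 h"
    "\<And>w. w \<in> lists {..<k} \<Longrightarrow> incseq (\<lambda>t. h [list_encode w, t])"
    "\<And>w. w \<in> lists {..<k} \<Longrightarrow> (\<lambda>t. h [list_encode w, t]) \<longlonglongrightarrow> f w"
    using assms unfolding lower_semicomputable_def by blast
  obtain p r where pr: "recursive 2 p" "recursive 2 r" "\<And>xs. length xs = 2
      \<Longrightarrow> h xs = real (p xs) / real (Suc (r xs))"
    using h(1) by (rule computable_nnratE) blast
  \<comment> \<open>With \<open>t = xs ! 1\<close>, the quotient \<open>(P - Q) / Suc S\<close> is
    \<open>h xs - 1 / Suc t\<close> over a common denominator.\<close>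
  define P where "P xs = p xs * Suc (xs ! 1)" for xs
  define Q where "Q xs = Suc (r xs)" for xs
  define S where "S xs = Suc (r xs) * Suc (xs ! 1) - 1" for xs
  define g :: "nat list \<Rightarrow> rat" where "g xs = (of_nat (P xs) - of_nat (Q xs)) / of_nat (Suc (S xs))" for xs
  have "recursive 2 P" "recursive 2 Q" "recursive 2 S"
    unfolding P_def Q_def S_def by (intro recursive_mult recursive_Suc recursive_diff recursive_const
        recursive_nth pr; simp)+
  then obtain P' Q' S' where *: "recursive_fn 2 P'" "recursive_fn 2 Q'" "recursive_fn 2 S'"
    "\<And>xs. length xs = 2 \<Longrightarrow> P xs = P' xs \<and> Q xs = Q' xs \<and> S xs = S' xs"
    unfolding recursive_def by metis
  then have "computable_rat_fn 2 g"
    unfolding computable_rat_fn_def g_def by (metis (no_types, lifting))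
  moreover have g: "real_of_rat (g [c, t]) = h [c, t] - 1 / real (Suc t)" for c t
  proof -
    have "Suc (S [c, t]) = Suc (r [c, t]) * Suc t"
      by (simp add: S_def)
    moreover have "real_of_rat (g [c, t]) = (real (P [c, t]) - real (Q [c, t])) / real (Suc (S [c, t]))"
      unfolding g_def by (simp add: of_rat_divide of_rat_diff del: of_nat_Suc)
    ultimately have "real_of_rat (g [c, t]) =
        (real (p [c, t]) * real (Suc t) - real (Suc (r [c, t]))) / (real (Suc (r [c, t])) * real (Suc t))"
      by (simp add: P_def Q_def del: of_nat_Suc mult_Suc mult_Suc_right)
    also have "\<dots> = real (p [c, t]) / real (Suc (r [c, t])) - 1 / real (Suc t)"
      by (simp add: diff_divide_distrib del: of_nat_Suc)
    finally show ?thesis by (simp add: pr(3))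
  qed
  moreover have "mono (\<lambda>t. g [list_encode w, t]) \<and> (\<forall>t. of_rat (g [list_encode w, t]) < f w) \<and>
      (\<lambda>t. of_rat (g [list_encode w, t])) \<longlonglongrightarrow> f w" if w: "w \<in> lists {..<k}" for w
  proof (intro conjI allI)
    have "real_of_rat (g [list_encode w, s]) \<le> of_rat (g [list_encode w, t])" if "s \<le> t" for s t
      unfolding g using monoD[OF h(2)[OF w] that] that
      by (intro diff_mono) (auto intro!: divide_left_mono)
    then show "mono (\<lambda>t. g [list_encode w, t])"
      by (intro monoI) (simp add: of_rat_less_eq)
    show "of_rat (g [list_encode w, t]) < f w" for t
    proof -
      have "0 < 1 / real (Suc t)" by simp
      then show ?thesis
        unfolding g using incseq_le[OF h(2,3)[OF w], of t] by linarith
    qed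
    show "(\<lambda>t. of_rat (g [list_encode w, t])) \<longlonglongrightarrow> f w"
      unfolding g using tendsto_diff[OF h(3)[OF w] LIMSEQ_inverse_real_of_nat]
      by (simp add: inverse_eq_divide)
  qed
  ultimately show ?thesis
    unfolding constructive_def by blast
qed

lemma real_diff_eq_max: "real (m - n) = max 0 (real m - real n)"
  by auto

text \<open>Truncated subtraction of the numerators yields the positive part of each approximation,
  which has the same limit because \<open>f\<close> is nonnegative.\<close>

lemma constructive_imp_lower_semicomputable:
  assumes "constructive k f" and nonneg: "\<And>w. w \<in> lists {..<k} \<Longrightarrow> 0 \<le> f w"
  shows "lower_semicomputable k f"
proof -
  obtain g where g: "computable_rat_fn 2 g"
    "\<And>w. w \<in> lists {..<k} \<Longrightarrow> mono (\<lambda>t. g [list_encode w, t])"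
    "\<And>w. w \<in> lists {..<k} \<Longrightarrow> (\<lambda>t. of_rat (g [list_encode w, t])) \<longlonglongrightarrow> f w"
    using assms(1) unfolding constructive_def by blast
  obtain p q r where pqr: "recursive_fn 2 p" "recursive_fn 2 q" "recursive_fn 2 r"
    "\<And>xs. length xs = 2 \<Longrightarrow> g xs = (of_nat (p xs) - of_nat (q xs)) / of_nat (Suc (r xs))"
    using g(1) unfolding computable_rat_fn_def by metis
  define h where "h xs = real (p xs - q xs) / real (Suc (r xs))" for xs
  have "computable_nnrat 2 h"
    unfolding h_def by (intro computable_nnratI[of 2
        "\<lambda>xs. p xs - q xs" r] recursive_diff recursive_of_recursive_fn pqr) simp
  moreover have h: "h [c, t] = max 0 (of_rat (g [c, t]))" for c t
    unfolding h_def real_diff_eq_max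
    by (simp add: pqr(4) of_rat_divide of_rat_diff max_def zero_le_divide_iff del: of_nat_Suc)
  moreover have "incseq (\<lambda>t. h [list_encode w, t]) \<and> (\<lambda>t. h [list_encode w, t]) \<longlonglongrightarrow> f w"
    if w: "w \<in> lists {..<k}" for w
  proof
    show "incseq (\<lambda>t. h [list_encode w, t])"
      unfolding h using monoD[OF g(2)[OF w]]
      by (intro monoI max.mono order_refl) (simp add: of_rat_less_eq)
    show "(\<lambda>t. h [list_encode w, t]) \<longlonglongrightarrow> f w"
      using tendsto_max[OF tendsto_const g(3)[OF w], of 0] nonneg[OF w] by (simp add: h max_absorb2)
  qed
  ultimately show ?thesis
    unfolding lower_semicomputable_def by blast
qed

text \<open>Rational weights make the product exactly computable from the code of \<open>w\<close>;
  being nonnegative, they keep the approximations increasing.\<close>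

lemma lower_semicomputable_mult_prod_list:
  assumes "lower_semicomputable k f" and c: "\<And>a. a < k \<Longrightarrow> c a \<in> \<rat>" "\<And>a. a < k \<Longrightarrow> 0 \<le> c a"
  shows "lower_semicomputable k (\<lambda>w. f w * prod_list (map c w))"
proof -
  obtain h where h: "computable_nnrat 2 h"
    "\<And>w. w \<in> lists {..<k} \<Longrightarrow> incseq (\<lambda>t. h [list_encode w, t])"
    "\<And>w. w \<in> lists {..<k} \<Longrightarrow> (\<lambda>t. h [list_encode w, t]) \<longlonglongrightarrow> f w"
    using assms unfolding lower_semicomputable_def by blast
  define C where "C e = (\<Prod>i<code_length e. if code_nth e i < k then c (code_nth e i) else 0)" for e
  define h' where "h' xs = h [xs ! 0, xs ! 1] * C (xs ! 0)" for xs
  have "computable_nnrat 2 (\<lambda>xs. C (xs ! 0))"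
    unfolding C_def
    by (intro computable_nnrat_prod computable_nnrat_case_less computable_nnrat_const c
        recursive_code_nth recursive_code_length recursive_nth recursive_hd
        recursive_tl[where f = "\<lambda>xs. xs ! 0"]; simp)
  then have "computable_nnrat 2 h'"
    unfolding h'_def by (intro computable_nnrat_mult computable_nnrat_comp2[OF h(1)] recursive_nth)
        simp_all
  moreover have C: "C (list_encode w) = prod_list (map c w)" if "w \<in> lists {..<k}" for w
  proof -
    have "C (list_encode w) = (\<Prod>i<length w. c (w ! i))"
      using that nth_mem[of _ w] unfolding C_def code_length_list_encode
      by (intro prod.cong) (auto simp: code_nth_list_encode subset_iff)
    then show ?thesis
      by (simp add: prod.list_conv_set_nth atLeast0LessThan)
  qed
  moreover have "0 \<le> prod_list (map c w)" if "w \<in> lists {..<k}" for w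
    using that c(2) by (induction w) auto
  ultimately have "computable_nnrat 2 h' \<and> (\<forall>w \<in> lists {..<k}.
     incseq (\<lambda>t. h' [list_encode w, t]) \<and> (\<lambda>t. h' [list_encode w, t]) \<longlonglongrightarrow> f w * prod_list (map c w))"
    using h(2,3) unfolding h'_def incseq_def
    by (simp del: in_lists_conv_set add: mult_right_mono tendsto_mult)
  then show ?thesis
    unfolding lower_semicomputable_def by blast
qed

lemma lower_semicomputable_const_1: "lower_semicomputable k (\<lambda>w. 1)"
  unfolding lower_semicomputable_def by (intro exI[of _ "\<lambda>_. 1"])
      (auto intro: computable_nnrat_const simp: incseq_def)

lemma computable_real_approx_below:
  assumes "computable_real x" "0 \<le> x"
  obtains h where "computable_nnrat 1 h" "incseq (\<lambda>t. h [t])" "(\<lambda>t. h [t]) \<longlonglongrightarrow> x"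
proof -
  obtain f where f: "computable_rat_fn 1 f" "\<And>t. \<bar>of_rat (f [t]) - x\<bar> \<le> 1 / 2 ^ t"
    using assms(1) unfolding computable_real_def by blast
  obtain p q r where pqr: "recursive_fn 1 p" "recursive_fn 1 q" "recursive_fn 1 r"
    "\<And>xs. length xs = 1 \<Longrightarrow> f xs = (of_nat (p xs) - of_nat (q xs)) / of_nat (Suc (r xs))"
    using f(1) unfolding computable_rat_fn_def by metis
  \<comment> \<open>The positive part of \<open>f xs - 3 / 2 ^ t\<close> over a common denominator,
    where \<open>t = xs ! 0\<close>; truncation takes the positive part.\<close>
  define h where "h xs = real (p xs * 2 ^ (xs ! 0) - (q xs * 2 ^ (xs ! 0) + 3 * Suc (r xs)))
    / real (Suc (Suc (r xs) * 2 ^ (xs ! 0) - 1))" for xs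
  \<comment> \<open>The factor 3 makes y monotone: y t \<le> x - 2 / 2 ^ t \<le> y (Suc t).\<close>
  define y where "y t = real_of_rat (f [t]) - 3 / 2 ^ t" for t
  have "computable_nnrat 1 h"
    unfolding h_def
    by (rule computable_nnratI[OF _ _ refl]; intro recursive_diff recursive_mult recursive_power
        recursive_Suc recursive_add recursive_const recursive_nth
        recursive_of_recursive_fn[OF pqr(1)] recursive_of_recursive_fn[OF pqr(2)]
            recursive_of_recursive_fn[OF pqr(3)]; simp)
  moreover have h: "h [t] = max 0 (y t)" for t
  proof -
    have pos: "0 < real (Suc (r [t])) * 2 ^ t"
      by simp
    have "y t = (real (p [t]) * 2 ^ t - (real (q [t]) * 2 ^ t + 3 * real (Suc (r [t]))))
        / (real (Suc (r [t])) * 2 ^ t)"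
      unfolding y_def pqr(4)[of "[t]", simplified] of_rat_divide
      by (simp add: of_rat_diff of_rat_add divide_simps) (simp add: algebra_simps)
    moreover have "h [t] = max 0 (real (p [t]) * 2 ^ t - (real (q [t]) * 2 ^ t + 3 * real (Suc (r [t]))))
        / (real (Suc (r [t])) * 2 ^ t)"
      unfolding h_def real_diff_eq_max by (simp del: of_nat_Suc mult_Suc mult_Suc_right)
    ultimately show ?thesis
      using pos by (simp add: max_def divide_less_0_iff zero_le_divide_iff not_le del: of_nat_Suc)
  qed
  moreover have "y t \<le> y (Suc t)" for t
    using f(2)[of t] f(2)[of "Suc t"] unfolding y_def abs_le_iff by simp
  then have "incseq (\<lambda>t. h [t])"
    unfolding h by (intro incseq_SucI max.mono order_refl)
  moreover have "(\<lambda>t. h [t]) \<longlonglongrightarrow> x"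
  proof -
    have half: "(\<lambda>t. 1 / 2 ^ t :: real) \<longlonglongrightarrow> 0"
      using LIMSEQ_power_zero[of "1 / 2 :: real"] by (simp add: power_divide)
    have "(\<lambda>t. of_rat (f [t]) - x) \<longlonglongrightarrow> 0"
      by (intro tendsto_rabs_zero_cancel[OF tendsto_sandwich[OF _ _ tendsto_const half]]
          always_eventually)
        (simp_all add: f(2))
    then have "(\<lambda>t. of_rat (f [t])) \<longlonglongrightarrow> x"
      by (simp add: LIM_zero_iff)
    then have "y \<longlonglongrightarrow> x - 3 * 0"
      unfolding y_def using tendsto_diff[OF _ tendsto_mult[OF tendsto_const half, of 3]] by fastforce
    then show ?thesis
      unfolding h using tendsto_max[OF tendsto_const, of y x sequentially 0] assms(2) by
          (simp add: max_absorb2)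
  qed
  ultimately show thesis
    using that by blast
qed

section \<open>Martingales above strict supermartingales\<close>

text \<open>The conditional probability of the cylinder of v given the cylinder of w.\<close>

definition cond_cylinder :: "(nat \<Rightarrow> real) \<Rightarrow> nat list \<Rightarrow> nat list \<Rightarrow> real" where
  "cond_cylinder \<alpha> v w = (if \<forall>i<min (length v) (length w). v ! i = w ! i
     then \<Prod>i<length v - length w. \<alpha> (v ! (length w + i)) else 0)"

lemma cond_cylinder_nonneg:
  assumes "\<And>a. a < k \<Longrightarrow> 0 < \<alpha> a" "v \<in> lists {..<k}"
  shows "0 \<le> cond_cylinder \<alpha> v w"
proof -
  have "v ! (length w + i) < k" if "i < length v - length w" for i
    using assms(2) nth_mem[of "length w + i" v] that by fastforce
  then show ?thesis
    using assms(1) by (auto simp: cond_cylinder_def less_imp_le intro!: prod_nonneg)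
qed

lemma cond_cylinder_self: "cond_cylinder \<alpha> w w = 1"
  by (simp add: cond_cylinder_def)

lemma prod_list_map_conv_prod: "prod_list (map c w) = (\<Prod>i<length w. c (w ! i))"
  by (simp add: prod.list_conv_set_nth atLeast0LessThan)

lemma prod_list_map_pos:
  fixes c :: "nat \<Rightarrow> real"
  shows "w \<in> lists {..<k} \<Longrightarrow> (\<And>a. a < k \<Longrightarrow> 0 < c a) \<Longrightarrow> 0 < prod_list (map c w)"
  by (induction w) auto

lemma prod_lessThan_add:
  fixes g :: "nat \<Rightarrow> 'a::comm_monoid_mult"
  shows "(\<Prod>i<m + n. g i) = (\<Prod>i<m. g i) * (\<Prod>i<n. g (m + i))"
  by (induction n) (simp_all add: mult.assoc)

text \<open>The left side is the measure of the intersection of the two cylinders. If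
  \<open>v\<close> is a prefix of \<open>w\<close>, the surplus factors of \<open>w\<close> are at
  most 1; if \<open>v\<close> properly extends \<open>w\<close>, equality holds.\<close>

lemma cond_cylinder_mult_le:
  assumes \<alpha>: "\<And>a. a < k \<Longrightarrow> 0 < \<alpha> a" "\<And>a. a < k \<Longrightarrow> \<alpha> a \<le> 1"
    and v: "v \<in> lists {..<k}" and w: "w \<in> lists {..<k}"
  shows "cond_cylinder \<alpha> v w * prod_list (map \<alpha> w) \<le> prod_list (map \<alpha> v)"
proof (cases "\<forall>i<min (length v) (length w). v ! i = w ! i")
  case True
  have v_nth: "v ! i < k" if "i < length v" for i
    using v nth_mem[OF that] by auto
  have w_nth: "w ! i < k" if "i < length w" for i
    using w nth_mem[OF that] by auto
  show ?thesis
  proof (cases "length v \<le> length w")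
    case le: True
    have "prod_list (map \<alpha> w) = (\<Prod>i<length v. \<alpha> (w ! i)) * (\<Prod>i\<in>{length v..<length w}. \<alpha> (w ! i))"
      unfolding prod_list_map_conv_prod using le
      by (subst prod.union_disjoint[symmetric]) (auto intro!: prod.cong)
    also have "\<dots> \<le> (\<Prod>i<length v. \<alpha> (w ! i)) * 1"
      using le w_nth \<alpha> by (intro mult_left_mono prod_le_1 prod_nonneg) (auto intro: less_imp_le)
    also have "\<dots> = prod_list (map \<alpha> v)"
      unfolding prod_list_map_conv_prod using True le by (simp add: min_def)
    finally show ?thesis
      using True le by (simp add: cond_cylinder_def)
  next
    case gt: False
    have "prod_list (map \<alpha> v) = (\<Prod>i<length w + (length v - length w). \<alpha> (v ! i))"
      unfolding prod_list_map_conv_prod using gt by simp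
    also have "\<dots> = (\<Prod>i<length w. \<alpha> (v ! i)) * (\<Prod>i<length v - length w. \<alpha> (v ! (length w + i)))"
      by (rule prod_lessThan_add)
    finally show ?thesis
      unfolding prod_list_map_conv_prod using True gt by (simp add: cond_cylinder_def min_def)
  qed
next
  case False
  have "0 \<le> prod_list (map \<alpha> v)"
    using prod_list_map_pos[of v k \<alpha>] v \<alpha>(1) by simp
  then show ?thesis
    unfolding cond_cylinder_def if_not_P[OF False] by simp
qed

text \<open>Once \<open>w\<close> is as long as \<open>v\<close>, the value no longer changes.
  Before that only the next symbol of \<open>v\<close> can contribute, and its weight is the first
  factor of the product.\<close>

lemma cond_cylinder_martingale:
  assumes \<alpha>: "(\<Sum>a<k. \<alpha> a) = 1" and v: "v \<in> lists {..<k}"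
  shows "(\<Sum>a<k. cond_cylinder \<alpha> v (w @ [a]) * \<alpha> a) = cond_cylinder \<alpha> v w"
proof (cases "length v \<le> length w")
  case True
  then have "cond_cylinder \<alpha> v (w @ [a]) = cond_cylinder \<alpha> v w" for a
    by (auto simp: cond_cylinder_def nth_append min_def)
  then show ?thesis
    using \<alpha> by (simp add: sum_distrib_left[symmetric])
next
  case False
  let ?b = "v ! length w"
  have b: "?b < k"
    using False v nth_mem[of "length w" v] by auto
  obtain m where m: "length v - length w = Suc m"
    using False by (metis Suc_diff_Suc not_le)
  then have m': "length v - Suc (length w) = m"
    by simp
  have "cond_cylinder \<alpha> v (w @ [a]) * \<alpha> a = (if a = ?b then cond_cylinder \<alpha> v w else 0)" for a
  proof -
    have "(\<forall>i<min (length v) (length (w @ [a])). v ! i = (w @ [a]) ! i) \<longleftrightarrow>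
        (\<forall>i<min (length v) (length w). v ! i = w ! i) \<and> ?b = a"
      using False by (auto simp: nth_append min_absorb2 All_less_Suc)
    then show ?thesis
      by (auto simp: cond_cylinder_def m m' prod.lessThan_Suc_shift simp del: prod.lessThan_Suc)
  qed
  then show ?thesis
    using b by (simp add: sum.delta)
qed

section \<open>Averages over words of a fixed length\<close>

definition words :: "nat \<Rightarrow> nat \<Rightarrow> nat list set" where
  "words k n = {v \<in> lists {..<k}. length v = n}"

lemma finite_words: "finite (words k n)"
  unfolding words_def using finite_lists_length_eq[of "{..<k}" n] by (simp add: lists_eq_set)

lemma sum_words_Suc: "(\<Sum>v\<in>words k (Suc n). g v) = (\<Sum>v\<in>words k n. \<Sum>a<k. g (v @ [a]))"
proof -
  have "words k (Suc n) = (\<lambda>(v, a). v @ [a]) ` (words k n \<times> {..<k})"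
  proof (intro equalityI subsetI)
    fix u assume u: "u \<in> words k (Suc n)"
    then have "u \<noteq> []"
      by (auto simp: words_def)
    then have "u = butlast u @ [last u]" "u \<noteq> []"
      by simp_all
    with u show "u \<in> (\<lambda>(v, a). v @ [a]) ` (words k n \<times> {..<k})"
      by (intro image_eqI[of _ _ "(butlast u, last u)"]) (auto simp: words_def dest: in_set_butlastD)
  qed (auto simp: words_def)
  moreover have "inj_on (\<lambda>(v, a). v @ [a]) (words k n \<times> {..<k})"
    by (auto simp: inj_on_def)
  ultimately show ?thesis
    by (simp add: sum.reindex sum.cartesian_product case_prod_unfold)
qed

text \<open>Summing out the last symbol costs one factor \<theta>, so the \<alpha>-average of
  \<open>f\<close> over words of length \<open>n\<close> decays geometrically.\<close>

lemma sum_words_le: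
  fixes f :: "nat list \<Rightarrow> real"
  assumes \<alpha>: "\<And>a. a < k \<Longrightarrow> 0 < \<alpha> a" and \<theta>: "0 \<le> \<theta>"
    and f: "\<And>w. w \<in> lists {..<k} \<Longrightarrow> (\<Sum>a<k. f (w @ [a]) * \<alpha> a) \<le> \<theta> * f w"
  shows "(\<Sum>v\<in>words k n. f v * prod_list (map \<alpha> v)) \<le> \<theta> ^ n * f []"
proof (induction n)
  case 0
  have "words k 0 = {[]}"
    by (auto simp: words_def)
  then show ?case by simp
next
  case (Suc n)
  have "(\<Sum>v\<in>words k (Suc n). f v * prod_list (map \<alpha> v))
      = (\<Sum>v\<in>words k n. (\<Sum>a<k. f (v @ [a]) * \<alpha> a) * prod_list (map \<alpha> v))"
    unfolding sum_words_Suc by (simp add: sum_distrib_left sum_distrib_right mult_ac)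
  also have "\<dots> \<le> (\<Sum>v\<in>words k n. \<theta> * f v * prod_list (map \<alpha> v))"
  proof (intro sum_mono mult_right_mono)
    fix v assume v: "v \<in> words k n"
    then show "(\<Sum>a<k. f (v @ [a]) * \<alpha> a) \<le> \<theta> * f v"
      by (simp add: f words_def)
    show "0 \<le> prod_list (map \<alpha> v)"
      using prod_list_map_pos[of v k \<alpha>] v \<alpha> by (simp add: words_def)
  qed
  also have "\<dots> = \<theta> * (\<Sum>v\<in>words k n. f v * prod_list (map \<alpha> v))"
    by (simp add: sum_distrib_left mult.assoc)
  also have "\<dots> \<le> \<theta> * (\<theta> ^ n * f [])"
    using Suc \<theta> by (intro mult_left_mono)
  finally show ?case by simp
qed

text \<open>Monotone convergence with one stage \<open>t\<close> for both the truncation of the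
  series and the approximation of its terms, so that a single computable sequence approximates the
  sum.\<close>

lemma tendsto_diagonal_sum:
  fixes F :: "nat \<Rightarrow> real"
  assumes nonneg: "\<And>t e. 0 \<le> G t e" and mono: "\<And>e. incseq (\<lambda>t. G t e)"
    and lim: "\<And>e. (\<lambda>t. G t e) \<longlonglongrightarrow> F e" and F: "summable F"
  shows "incseq (\<lambda>t. \<Sum>e<t. G t e)" and "(\<lambda>t. \<Sum>e<t. G t e) \<longlonglongrightarrow> suminf F"
proof -
  have le: "G t e \<le> F e" for t e
    using incseq_le[OF mono lim] .
  then have F0: "0 \<le> F e" for e
    using nonneg order.trans by blast
  show inc: "incseq (\<lambda>t. \<Sum>e<t. G t e)"
  proof (rule incseq_SucI)
    fix t
    have "(\<Sum>e<t. G t e) \<le> (\<Sum>e<t. G (Suc t) e)"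
      by (intro sum_mono incseq_SucD mono)
    then show "(\<Sum>e<t. G t e) \<le> (\<Sum>e<Suc t. G (Suc t) e)"
      using nonneg[of "Suc t" t] by simp
  qed
  have bound: "(\<Sum>e<t. G t e) \<le> suminf F" for t
  proof -
    have "(\<Sum>e<t. G t e) \<le> (\<Sum>e<t. F e)"
      by (intro sum_mono le)
    also have "\<dots> \<le> suminf F"
      by (intro sum_le_suminf F F0) auto
    finally show ?thesis .
  qed
  then obtain L where L: "(\<lambda>t. \<Sum>e<t. G t e) \<longlonglongrightarrow> L" "\<And>t. (\<Sum>e<t. G t e) \<le> L"
    using incseq_convergent[OF inc] by metis
  \<comment> \<open>For fixed \<open>N\<close> the terms with \<open>e < N\<close> are part of every
    diagonal sum with \<open>N \<le> t\<close>; letting \<open>t\<close> grow bounds each partial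
    sum of \<open>F\<close> by \<open>L\<close>.\<close>
  have "suminf F \<le> L"
  proof (rule suminf_le_const[OF F])
    fix N
    have "(\<lambda>t. \<Sum>e<N. G t e) \<longlonglongrightarrow> (\<Sum>e<N. F e)"
      by (intro tendsto_sum lim)
    moreover have "(\<Sum>e<N. G t e) \<le> L" if "N \<le> t" for t
    proof -
      have "(\<Sum>e<N. G t e) \<le> (\<Sum>e<t. G t e)"
        using that nonneg by (intro sum_mono2) auto
      then show ?thesis using L(2)[of t] by linarith
    qed
    ultimately show "(\<Sum>e<N. F e) \<le> L"
      by (intro LIMSEQ_le_const2) auto
  qed
  moreover have "L \<le> suminf F"
    by (intro LIMSEQ_le_const2[OF L(1)]) (auto intro: bound)
  ultimately show "(\<lambda>t. \<Sum>e<t. G t e) \<longlonglongrightarrow> suminf F"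
    using L(1) by simp
qed

text \<open>Every summand of the series over \<open>v\<close> is a martingale in \<open>w\<close>,
  the summand \<open>v = w\<close> gives domination, and \<open>\<theta> < 1\<close> gives
  convergence by comparison with a geometric series. All ingredients are nonnegative and
  approximable from below, hence so is the sum.\<close>

lemma martingale_above_strict_supermartingale:
  assumes \<alpha>: "prob_measure_on k \<alpha>" "positive_measure k \<alpha>" "computable_measure k \<alpha>"
    and f: "lower_semicomputable k f" and \<theta>: "0 \<le> \<theta>" "\<theta> < 1"
    and super: "\<And>w. w \<in> lists {..<k} \<Longrightarrow> (\<Sum>a<k. f (w @ [a]) * \<alpha> a) \<le> \<theta> * f w"
  obtains m where "martingale k \<alpha> m" "constructive k m" "\<And>w. w \<in> lists {..<k} \<Longrightarrow> f w \<le> m w"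
proof -
  have pos: "0 < \<alpha> a" "\<alpha> a \<le> 1" if "a < k" for a
    using \<alpha> that by (auto simp: prob_measure_on_def positive_measure_def)
  have sum1: "(\<Sum>a<k. \<alpha> a) = 1"
    using \<alpha>(1) by (simp add: prob_measure_on_def)
  obtain h where h: "computable_nnrat 2 h"
    "\<And>w. w \<in> lists {..<k} \<Longrightarrow> incseq (\<lambda>t. h [list_encode w, t])"
    "\<And>w. w \<in> lists {..<k} \<Longrightarrow> (\<lambda>t. h [list_encode w, t]) \<longlonglongrightarrow> f w"
    using f unfolding lower_semicomputable_def by blast
  have h0: "0 \<le> h [c, t]" for c t
    by (rule computable_nnrat_nonneg[OF h(1)]) simp
  have f0: "0 \<le> f w" if "w \<in> lists {..<k}" for w
    by (rule LIMSEQ_le_const[OF h(3)[OF that]]) (use h0 in auto)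
  have "\<forall>a\<in>{..<k}. \<exists>g. computable_nnrat 1 g \<and> incseq (\<lambda>t. g [t]) \<and> (\<lambda>t. g [t]) \<longlonglongrightarrow> \<alpha> a"
    using \<alpha>(3) pos(1) unfolding computable_measure_def
    by (metis computable_real_approx_below less_imp_le lessThan_iff)
  from bchoice[OF this] obtain g where g: "\<And>a. a < k \<Longrightarrow> computable_nnrat 1 (g a)"
    "\<And>a. a < k \<Longrightarrow> incseq (\<lambda>t. g a [t])" "\<And>a. a < k \<Longrightarrow> (\<lambda>t. g a [t]) \<longlonglongrightarrow> \<alpha> a"
    by auto
  have g0: "0 \<le> g a [t]" if "a < k" for a t
    by (rule computable_nnrat_nonneg[OF g(1)[OF that]]) simp

  \<comment> \<open>Words are indexed by their codes to obtain a series over the naturals; codes of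
    lists outside the alphabet contribute 0.\<close>
  define F where "F w e = (if list_decode e \<in> lists {..<k}
    then f (list_decode e) * cond_cylinder \<alpha> (list_decode e) w else 0)" for w e
  define m where "m w = suminf (F w)" for w
  have F0: "0 \<le> F w e" for w e
    unfolding F_def using f0 cond_cylinder_nonneg[of k \<alpha>] pos(1) by simp

  have F_summable: "summable (F w)" if w: "w \<in> lists {..<k}" for w
  proof (rule summableI_nonneg_bounded[OF F0])
    fix N
    have posw: "0 < prod_list (map \<alpha> w)"
      using prod_list_map_pos[OF w] pos(1) by blast
    \<comment> \<open>A word with code below \<open>N\<close> has length less than \<open>N\<close>,
      so these words cover all terms of the partial sum.\<close>
    let ?V = "\<Union>n<Suc N. words k n"
    let ?T = "\<lambda>v. f v * cond_cylinder \<alpha> v w"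
    have T0: "0 \<le> ?T v" if "v \<in> ?V" for v
      using that f0 cond_cylinder_nonneg[of k \<alpha>] pos(1) by (auto simp: words_def)
    have "(\<Sum>e<N. F w e) = (\<Sum>e \<in> {e. e < N \<and> list_decode e \<in> lists {..<k}}. ?T (list_decode e))"
      unfolding F_def by (subst sum.inter_filter[symmetric]) auto
    also have "\<dots> = sum ?T (list_decode ` {e. e < N \<and> list_decode e \<in> lists {..<k}})"
      by (subst sum.reindex) (auto intro: inj_on_subset[OF inj_list_decode])
    also have "\<dots> \<le> sum ?T ?V"
    proof (rule sum_mono2)
      have "length (list_decode e) < Suc N" if "e < N" for e
        using length_le_list_encode[of "list_decode e"] that by simp
      then show "list_decode ` {e. e < N \<and> list_decode e \<in> lists {..<k}} \<subseteq> ?V"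
        by (auto simp: words_def)
    qed (use T0 finite_words in auto)
    also have "\<dots> = (\<Sum>n<Suc N. sum ?T (words k n))"
      by (subst sum.UNION_disjoint) (auto simp: finite_words, auto simp: words_def)
    also have "\<dots> \<le> (\<Sum>n<Suc N. \<theta> ^ n * f [] / prod_list (map \<alpha> w))"
    proof (rule sum_mono)
      fix n
      \<comment> \<open>Conditioning on \<open>w\<close> costs at most the factor
        \<open>1 / prod_list (map \<alpha> w)\<close>, which does not depend on
        \<open>n\<close>.\<close>
      have "sum ?T (words k n) \<le> (\<Sum>v\<in>words k n. f v * (prod_list (map \<alpha> v) / prod_list (map \<alpha> w)))"
        using f0 cond_cylinder_mult_le[of k \<alpha> _ w] pos w posw
        by (intro sum_mono mult_left_mono) (auto simp: words_def pos_le_divide_eq)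
      also have "\<dots> \<le> \<theta> ^ n * f [] / prod_list (map \<alpha> w)"
        using sum_words_le[of k \<alpha> \<theta> f n] pos(1) \<theta>(1) super posw
        by (simp add: sum_divide_distrib[symmetric] divide_right_mono)
      finally show "sum ?T (words k n) \<le> \<theta> ^ n * f [] / prod_list (map \<alpha> w)" .
    qed
    also have "\<dots> = (\<Sum>n<Suc N. \<theta> ^ n) * (f [] / prod_list (map \<alpha> w))"
      by (simp add: sum_distrib_right sum_divide_distrib del: sum.lessThan_Suc)
    also have "\<dots> \<le> (\<Sum>n. \<theta> ^ n) * (f [] / prod_list (map \<alpha> w))"
      using \<theta> f0[of "[]"] posw
      by (intro mult_right_mono sum_le_suminf summable_geometric divide_nonneg_pos) auto
    finally show "(\<Sum>e<N. F w e) \<le> (\<Sum>n. \<theta> ^ n) * (f [] / prod_list (map \<alpha> w))" .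
  qed

  have "martingale k \<alpha> m"
    unfolding gale_def
  proof (intro ballI conjI)
    fix w assume w: "w \<in> lists {..<k}"
    show "0 \<le> m w"
      unfolding m_def by (intro suminf_nonneg F_summable F0 w)
    have wa: "w @ [a] \<in> lists {..<k}" if "a < k" for a
      using w that by simp
    have "(\<Sum>a<k. m (w @ [a]) * \<alpha> a powr 1) = (\<Sum>a<k. \<Sum>e. F (w @ [a]) e * \<alpha> a)"
      unfolding m_def using pos(1) wa by (intro sum.cong) (auto simp: suminf_mult2 F_summable abs_of_pos)
    also have "\<dots> = (\<Sum>e. \<Sum>a<k. F (w @ [a]) e * \<alpha> a)"
      using wa F_summable by (intro suminf_sum[symmetric] summable_mult2) auto
    also have "(\<lambda>e. \<Sum>a<k. F (w @ [a]) e * \<alpha> a) = F w"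
    proof
      fix e
      show "(\<Sum>a<k. F (w @ [a]) e * \<alpha> a) = F w e"
        using cond_cylinder_martingale[OF sum1, of "list_decode e" w]
        by (simp add: F_def mult.assoc sum_distrib_left[symmetric])
    qed
    finally show "m w = (\<Sum>a<k. m (w @ [a]) * \<alpha> a powr 1)"
      by (simp add: m_def)
  qed

  moreover have "f w \<le> m w" if w: "w \<in> lists {..<k}" for w
    using sum_le_suminf[OF F_summable[OF w], of "{list_encode w}"] F0 w
    by (simp add: F_def m_def cond_cylinder_self)

  moreover have "lower_semicomputable k m"
  proof -
    \<comment> \<open>Counterparts on codes of membership in the alphabet, agreement of the two
      words, and the conditional weight with \<open>g\<close> approximating \<alpha>.\<close>
    define valid where "valid e \<longleftrightarrow> (\<forall>i<code_length e. code_nth e i < k)" for e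
    define compat where "compat e c \<longleftrightarrow> (\<forall>i<min (code_length e) (code_length c). code_nth e i = code_nth c
        i)" for e c
    define tail where "tail e c t = (\<Prod>i<code_length e - code_length c.
      if code_nth e (code_length c + i) < k then g (code_nth e (code_length c + i)) [t] else 0)" for e c t
    define G where "G c t e = (if valid e \<and> compat e c then h [e, t] * tail e c t else 0)" for c t e
    \<comment> \<open>Stage \<open>t\<close> sums the first \<open>t\<close> terms, each
      approximated to stage \<open>t\<close>.\<close>
    define h' where "h' xs = (\<Sum>e<xs ! 1. G (xs ! 0) (xs ! 1) e)" for xs

    have recursive_valid: "decidable n (\<lambda>xs. valid (e xs))" if "recursive n e" for n e
      unfolding valid_def
      by (intro decidable_all_less decidable_less recursive_code_nth recursive_code_length
          recursive_const recursive_hd recursive_tl[OF that] that zero_less_Suc)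
    have recursive_compat: "decidable n (\<lambda>xs. compat (e xs) (c xs))" if "recursive n e" "recursive n c"
        for n e c
      unfolding compat_def
      by (intro decidable_all_less decidable_eq recursive_code_nth recursive_min recursive_code_length
          recursive_const recursive_hd
          recursive_tl[OF that(1)] recursive_tl[OF that(2)] that zero_less_Suc)
    have computable_nnrat_tail: "computable_nnrat n (\<lambda>xs. tail (e xs) (c xs) (t xs))" if "recursive n e"
        "recursive n c" "recursive n t" for n e c t
      unfolding tail_def
      by (intro computable_nnrat_prod computable_nnrat_case_less computable_nnrat_comp1[OF g(1)]
          recursive_code_nth recursive_add recursive_diff recursive_code_length recursive_const
          recursive_hd
          recursive_tl[OF that(1)] recursive_tl[OF that(2)] recursive_tl[OF that(3)] that zero_less_Suc)
    have computable_nnrat_G: "computable_nnrat n (\<lambda>xs. G (c xs) (t xs) (e xs))" if "recursive n e"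
        "recursive n c" "recursive n t" for n e c t
      unfolding G_def
      by (intro computable_nnrat_if decidable_conj recursive_valid recursive_compat
          computable_nnrat_mult computable_nnrat_comp2[OF h(1)] computable_nnrat_tail
          computable_nnrat_const that) auto
    have "computable_nnrat 2 h'"
      unfolding h'_def
      by (intro computable_nnrat_sum computable_nnrat_G recursive_hd recursive_tl[OF recursive_nth]
          recursive_nth) auto

    moreover have "incseq (\<lambda>t. h' [list_encode w, t]) \<and> (\<lambda>t. h' [list_encode w, t]) \<longlonglongrightarrow> m w"
      if w: "w \<in> lists {..<k}" for w
    proof -
      have G: "G (list_encode w) t e = (if list_decode e \<in> lists {..<k} \<and>
          (\<forall>i<min (length (list_decode e)) (length w). list_decode e ! i = w ! i)
          then h [e, t] * (\<Prod>i<length (list_decode e) - length w. g (list_decode e ! (length w + i)) [t])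
              else 0)"
        for t e
      proof -
        obtain v where v: "e = list_encode v" "list_decode e = v"
          by (metis list_decode_inverse)
        have "valid e \<longleftrightarrow> v \<in> lists {..<k}"
          unfolding valid_def v(1) code_length_list_encode
          by (simp add: code_nth_list_encode in_lists_conv_set all_set_conv_all_nth)
        moreover have "compat e (list_encode w) \<longleftrightarrow> (\<forall>i<min (length v) (length w). v ! i = w ! i)"
          unfolding compat_def v(1) code_length_list_encode by (auto simp: code_nth_list_encode)
        moreover have "tail e (list_encode w) t = (\<Prod>i<length v - length w. g (v ! (length w + i)) [t])"
          if "v \<in> lists {..<k}"
          using that nth_mem[of _ v] unfolding tail_def v(1) code_length_list_encode
          by (intro prod.cong) (auto simp: code_nth_list_encode)
        ultimately show ?thesis
          unfolding G_def v(2) by auto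
      qed
      have nth: "list_decode e ! (length w + i) < k"
        if "list_decode e \<in> lists {..<k}" "i < length (list_decode e) - length w" for e i
        using that nth_mem[of "length w + i" "list_decode e"] by fastforce
      have "0 \<le> G (list_encode w) t e \<and> incseq (\<lambda>t. G (list_encode w) t e) \<and>
          (\<lambda>t. G (list_encode w) t e) \<longlonglongrightarrow> F w e" for t e
      proof (cases "list_decode e \<in> lists {..<k} \<and>
          (\<forall>i<min (length (list_decode e)) (length w). list_decode e ! i = w ! i)")
        case False
        then show ?thesis
          unfolding G F_def cond_cylinder_def if_not_P[OF False] by (auto simp: incseq_def)
      next
        case True
        let ?v = "list_decode e"
        let ?P = "\<lambda>t. \<Prod>i<length ?v - length w. g (?v ! (length w + i)) [t]"
        have v: "?v \<in> lists {..<k}"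
          using True by blast
        have P0: "0 \<le> ?P t" for t
          using nth[OF v] by (intro prod_nonneg) (simp add: g0)
        have "?P t \<le> ?P (Suc t)" for t
          using nth[OF v] by (intro prod_mono) (simp add: g0 incseq_SucD[OF g(2)])
        moreover have "h [e, t] \<le> h [e, Suc t]" for t
          using incseq_SucD[OF h(2)[OF v]] by simp
        ultimately have "incseq (\<lambda>t. h [e, t] * ?P t)"
          by (intro incseq_SucI mult_mono P0 h0)
        moreover have "(\<lambda>t. h [e, t] * ?P t) \<longlonglongrightarrow> f ?v * (\<Prod>i<length ?v - length w. \<alpha> (?v ! (length w + i)))"
          using h(3)[OF v] nth[OF v] by (intro tendsto_mult tendsto_prod) (simp_all add: g(3))
        moreover have "0 \<le> h [e, t] * ?P t"
          using P0 h0 by (intro mult_nonneg_nonneg)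
        moreover have "F w e = f ?v * (\<Prod>i<length ?v - length w. \<alpha> (?v ! (length w + i)))"
          unfolding F_def cond_cylinder_def using True by presburger
        ultimately show ?thesis
          unfolding G if_P[OF True] by simp
      qed
      then show ?thesis
        unfolding h'_def m_def
        using tendsto_diagonal_sum[of "G (list_encode w)" "F w"] F_summable[OF w] by simp
    qed
    ultimately show ?thesis
      unfolding lower_semicomputable_def by blast
  qed
  ultimately show thesis
    using that lower_semicomputable_imp_constructive by blast
qed

section \<open>Random sequences\<close>

text \<open>The values are finite, so each initial segment is bounded, and an unbounded sequence
  must exceed every bound infinitely often.\<close>

lemma succeeds_iff_unbounded: "succeeds d S \<longleftrightarrow> (\<forall>B. \<exists>n. B < d (map S [0..<n]))"
proof
  assume S: "succeeds d S"
  show "\<forall>B. \<exists>n. B < d (map S [0..<n])"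
  proof (rule ccontr)
    assume "\<not> ?thesis"
    then obtain B where "\<And>n. d (map S [0..<n]) \<le> B"
      by (meson not_less)
    then have "limsup (\<lambda>n. ereal (d (map S [0..<n]))) \<le> ereal B"
      by (intro Limsup_bounded always_eventually) simp
    with S show False
      by (simp add: succeeds_def)
  qed
next
  assume unb: "\<forall>B. \<exists>n. B < d (map S [0..<n])"
  show "succeeds d S"
  proof (rule ccontr)
    assume "\<not> succeeds d S"
    then obtain r :: nat where "limsup (\<lambda>n. ereal (d (map S [0..<n]))) < ereal r"
      unfolding succeeds_def using less_PInf_Ex_of_nat by auto
    then have "eventually (\<lambda>n. ereal (d (map S [0..<n])) < ereal r) sequentially"
      by (rule Limsup_lessD)
    then obtain N where N: "\<And>n. N \<le> n \<Longrightarrow> d (map S [0..<n]) < r"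
      by (auto simp: eventually_sequentially)
    let ?M = "Max ((\<lambda>n. d (map S [0..<n])) ` {..N})"
    obtain n where n: "max (real r) ?M < d (map S [0..<n])"
      using unb by blast
    show False
    proof (cases "N \<le> n")
      case True
      then show ?thesis using N[of n] n by simp
    next
      case False
      then have "d (map S [0..<n]) \<le> ?M"
        by (intro Max_ge) auto
      then show ?thesis using n by linarith
    qed
  qed
qed

lemma rational_between_family:
  fixes l u :: "nat \<Rightarrow> real"
  assumes "\<And>a. a < k \<Longrightarrow> l a < u a"
  obtains c where "\<And>a. a < k \<Longrightarrow> c a \<in> \<rat>" "\<And>a. a < k \<Longrightarrow> l a < c a" "\<And>a. a < k \<Longrightarrow> c a < u a"
proof -
  have "\<forall>a\<in>{..<k}. \<exists>c. c \<in> \<rat> \<and> l a < c \<and> c < u a"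
    using assms Rats_dense_in_real by (metis lessThan_iff)
  from bchoice[OF this] show thesis
    using that by auto
qed

lemma prod_list_map_prefix: "prod_list (map c (map R [0..<n])) = (\<Prod>i<n. c (R i))"
  unfolding prod_list_map_conv_prod by simp

lemma prod_eq_exp_sum_ln:
  fixes c :: "nat \<Rightarrow> real" and R :: "nat \<Rightarrow> nat"
  assumes "\<And>i. 0 < c (R i)"
  shows "(\<Prod>i<n. c (R i)) = exp (\<Sum>i<n. ln (c (R i)))"
  using assms by (simp add: exp_sum)

lemma prefix_in_lists: "(\<forall>n. R n < k) \<Longrightarrow> map R [0..<n] \<in> lists {..<k}"
  by auto

section \<open>Consequences of \<alpha>-randomness\<close>

locale random_sequence =
  fixes k :: nat and \<alpha> :: "nat \<Rightarrow> real" and R :: "nat \<Rightarrow> nat"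
  assumes prob: "prob_measure_on k \<alpha>" and pos: "positive_measure k \<alpha>"
    and comp: "computable_measure k \<alpha>" and R: "\<forall>n. R n < k" and random: "random_wrt k \<alpha> R"
begin

lemma \<alpha>_pos: "a < k \<Longrightarrow> 0 < \<alpha> a"
  using pos by (simp add: positive_measure_def)

lemma sum_\<alpha>: "(\<Sum>a<k. \<alpha> a) = 1"
  using prob by (simp add: prob_measure_on_def)

lemma sum_\<alpha>_diff: "(\<Sum>a<k. \<alpha> a * (z a - e)) = (\<Sum>a<k. \<alpha> a * z a) - e"
  by (simp add: right_diff_distrib sum_subtractf sum_distrib_right[symmetric] sum_\<alpha>)

text \<open>Randomness is applied here: if \<open>f\<close> succeeded, so would the constructive
  martingale above it.\<close>

lemma strict_supermartingale_not_succeeds: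
  assumes "lower_semicomputable k f" "0 \<le> \<theta>" "\<theta> < 1"
    and "\<And>w. w \<in> lists {..<k} \<Longrightarrow> (\<Sum>a<k. f (w @ [a]) * \<alpha> a) \<le> \<theta> * f w"
  shows "\<not> succeeds f R"
proof
  assume f: "succeeds f R"
  obtain m where m: "martingale k \<alpha> m" "constructive k m" "\<And>w. w \<in> lists {..<k} \<Longrightarrow> f w \<le> m w"
    using martingale_above_strict_supermartingale[OF prob pos comp assms] by metis
  have "succeeds m R"
    using f m(3)[OF prefix_in_lists[OF R]] unfolding succeeds_iff_unbounded by (meson less_le_trans)
  with m random show False
    unfolding random_wrt_def by blast
qed

text \<open>A Chernoff argument in place of a law of large numbers: a product of weights with
  \<alpha>-mean below 1 stays bounded along \<open>R\<close>, and taking logarithms turns this into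
  linear growth. The real function \<open>x\<close> is arbitrary; only the weights \<open>c\<close>
  must be rational.\<close>

lemma birkhoff_sum_at_top:
  assumes x: "0 < (\<Sum>a<k. \<alpha> a * x a)"
  shows "filterlim (\<lambda>n. \<Sum>i<n. x (R i)) at_top sequentially"
proof -
  \<comment> \<open>Half of the mean stays with \<open>y\<close>, which keeps a positive mean; the
    other half becomes the linear growth rate.\<close>
  define \<delta> where "\<delta> = (\<Sum>a<k. \<alpha> a * x a) / 2"
  define y where "y a = x a - \<delta>" for a
  define \<phi> where "\<phi> l = (\<Sum>a<k. \<alpha> a * exp (- l * y a))" for l
  have \<delta>: "0 < \<delta>"
    using x by (simp add: \<delta>_def)
  have sum_y: "(\<Sum>a<k. \<alpha> a * y a) = \<delta>"
    unfolding y_def sum_\<alpha>_diff by (simp add: \<delta>_def)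
  \<comment> \<open>\<open>\<phi> 0 = 1\<close>, and the slope at 0 is minus the mean of
    \<open>y\<close>, hence negative; so \<phi> falls below 1 at some \<open>l > 0\<close>.\<close>
  have "(\<phi> has_real_derivative - (\<Sum>a<k. \<alpha> a * y a)) (at 0)"
    unfolding \<phi>_def by (auto intro!: derivative_eq_intros simp: sum_negf mult.commute)
  then obtain l where l: "0 < l" "\<phi> l < \<phi> 0"
    using DERIV_neg_dec_right[of \<phi> _ 0] sum_y \<delta>
    by (metis add.left_neutral dense neg_less_0_iff_less)
  then have "\<phi> l < 1"
    using sum_\<alpha> by (simp add: \<phi>_def)
  define \<theta> where "\<theta> = (1 + \<phi> l) / 2"
  have "0 \<le> \<phi> l"
    unfolding \<phi>_def using \<alpha>_pos by (intro sum_nonneg) (simp add: less_imp_le)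
  then have \<theta>: "0 \<le> \<theta>" "\<theta> < 1" "\<phi> l < \<theta>"
    using \<open>\<phi> l < 1\<close> by (simp_all add: \<theta>_def)
  \<comment> \<open>As \<alpha> sums to 1, raising each value by less than
    \<open>\<theta> - \<phi> l\<close> lifts the mean to at most \<theta>.\<close>
  obtain c where c: "\<And>a. a < k \<Longrightarrow> c a \<in> \<rat>" "\<And>a. a < k \<Longrightarrow> exp (- l * y a) < c a"
    "\<And>a. a < k \<Longrightarrow> c a < exp (- l * y a) - (\<phi> l - \<theta>)"
    by (rule rational_between_family[of k "\<lambda>a. exp (- l * y a)" "\<lambda>a. exp (- l * y a) - (\<phi> l - \<theta>)"])
        (use \<theta>(3) in simp, blast)
  have c_pos: "0 < c a" if "a < k" for a
    using c(2)[OF that] by (meson exp_gt_zero less_trans)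
  have "(\<Sum>a<k. c a * \<alpha> a) \<le> (\<Sum>a<k. \<alpha> a * (exp (- l * y a) - (\<phi> l - \<theta>)))"
    using c(3) \<alpha>_pos by (intro sum_mono) (simp add: mult.commute less_imp_le)
  also have "\<dots> = \<theta>"
    unfolding sum_\<alpha>_diff \<phi>_def[of l, symmetric] by simp
  finally have sum_c: "(\<Sum>a<k. c a * \<alpha> a) \<le> \<theta>" .
  define f where "f w = prod_list (map c w)" for w
  have "lower_semicomputable k f"
    using lower_semicomputable_mult_prod_list[OF lower_semicomputable_const_1, of k c] c(1) c_pos by
        (simp add: f_def[abs_def] less_imp_le)
  moreover have "(\<Sum>a<k. f (w @ [a]) * \<alpha> a) \<le> \<theta> * f w" if "w \<in> lists {..<k}" for w
  proof -
    have "(\<Sum>a<k. f (w @ [a]) * \<alpha> a) = f w * (\<Sum>a<k. c a * \<alpha> a)"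
      by (simp add: f_def sum_distrib_left mult.assoc)
    also have "\<dots> \<le> f w * \<theta>"
      using prod_list_map_pos[OF that] c_pos sum_c by (intro mult_left_mono)
          (auto simp: f_def less_imp_le)
    finally show ?thesis by (simp add: mult.commute)
  qed
  ultimately have "\<not> succeeds f R"
    using strict_supermartingale_not_succeeds \<theta> by blast
  then obtain B where B: "\<And>n. (\<Prod>i<n. c (R i)) \<le> B"
    unfolding succeeds_iff_unbounded f_def prod_list_map_prefix by (meson not_less)
  have B1: "0 < B"
    using B[of 0] by simp
  have lower: "- (ln B / l) + real n * \<delta> \<le> (\<Sum>i<n. x (R i))" for n
  proof -
    have "exp (\<Sum>i<n. - l * y (R i)) \<le> (\<Prod>i<n. c (R i))"
      using c(2) R by (simp add: exp_sum prod_mono less_imp_le)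
    then have "exp (\<Sum>i<n. - l * y (R i)) \<le> B"
      using B order.trans by blast
    then have "(\<Sum>i<n. - l * y (R i)) \<le> ln B"
      using B1 by (simp add: ln_ge_iff)
    moreover have "(\<Sum>i<n. - l * y (R i)) = l * (real n * \<delta> - (\<Sum>i<n. x (R i)))"
      by (simp add: y_def sum_distrib_left[symmetric] sum_negf sum_subtractf algebra_simps)
    ultimately show ?thesis
      using l(1) by (simp add: field_simps)
  qed
  have "filterlim (\<lambda>n. - (ln B / l) + real n * \<delta>) at_top sequentially"
    by (intro filterlim_tendsto_add_at_top[OF tendsto_const]
        filterlim_at_top_mult_tendsto_pos[OF tendsto_const \<delta> filterlim_real_sequentially])
  then show ?thesis
    by (rule filterlim_at_top_mono) (intro always_eventually allI lower)
qed

section \<open>Exponents of succeeding \<beta>-gales\<close>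

context
  fixes \<beta> :: "nat \<Rightarrow> real"
  assumes \<beta>: "positive_measure k \<beta>"
begin

private lemma \<beta>_pos: "a < k \<Longrightarrow> 0 < \<beta> a"
  using \<beta> by (simp add: positive_measure_def)

text \<open>The sum is \<open>s\<close> times the cross entropy minus the entropy, in natural
  logarithms. If it were negative, \<open>d\<close> times weights near
  \<open>\<beta> a powr s / \<alpha> a\<close> would be bounded along \<open>R\<close>, while the
  product of the weights tends to infinity there; so \<open>d\<close> could not succeed.\<close>

lemma gale_succeeds_imp_entropy_le:
  assumes d: "gale k s \<beta> d" "constructive k d" "succeeds d R"
  shows "(\<Sum>a<k. \<alpha> a * (ln (\<alpha> a) - s * ln (\<beta> a))) \<ge> 0"
proof (rule ccontr)
  assume neg: "\<not> ?thesis"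
  define \<mu> where "\<mu> = (\<Sum>a<k. \<alpha> a * (s * ln (\<beta> a) - ln (\<alpha> a)))"
  define z where "z a = s * ln (\<beta> a) - ln (\<alpha> a)" for a
  have "\<mu> = - (\<Sum>a<k. \<alpha> a * (ln (\<alpha> a) - s * ln (\<beta> a)))"
    by (simp add: \<mu>_def sum_negf[symmetric] algebra_simps)
  then have \<mu>: "0 < \<mu>"
    using neg by simp
  \<comment> \<open>The upper margin \<open>\<mu> / 3\<close> provides the contraction factor
    \<open>exp (- \<mu> / 3)\<close>; the lower margin \<open>\<mu> / 2\<close> leaves
    \<open>ln (c a)\<close> a mean of at least \<open>\<mu> / 2\<close>.\<close>
  obtain c where c: "\<And>a. a < k \<Longrightarrow> c a \<in> \<rat>" "\<And>a. a < k \<Longrightarrow> exp (z a - \<mu> / 2) < c a"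
    "\<And>a. a < k \<Longrightarrow> c a < exp (z a - \<mu> / 3)"
    by (rule rational_between_family[of k "\<lambda>a. exp (z a - \<mu> / 2)" "\<lambda>a. exp (z a - \<mu> / 3)"])
        (use \<mu> in simp, blast)
  have c_pos: "0 < c a" if "a < k" for a
    using c(2)[OF that] by (meson exp_gt_zero less_trans)
  define f where "f w = d w * prod_list (map c w)" for w
  have d0: "0 \<le> d w" and d_sum: "d w = (\<Sum>a<k. d (w @ [a]) * \<beta> a powr s)" if "w \<in> lists {..<k}" for w
    using d(1) that unfolding gale_def by blast+
  have "lower_semicomputable k f"
    unfolding f_def using constructive_imp_lower_semicomputable[OF d(2) d0] c(1) c_pos
    by (intro lower_semicomputable_mult_prod_list) (auto intro: less_imp_le)
  moreover have "(\<Sum>a<k. f (w @ [a]) * \<alpha> a) \<le> exp (- \<mu> / 3) * f w" if w: "w \<in> lists {..<k}" for w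
  proof -
    have P: "0 < prod_list (map c w)"
      using prod_list_map_pos[OF w] c_pos by blast
    have "c a * \<alpha> a \<le> exp (- \<mu> / 3) * \<beta> a powr s" if "a < k" for a
    proof -
      have "c a * \<alpha> a \<le> exp (z a - \<mu> / 3) * exp (ln (\<alpha> a))"
        using c(3)[OF that] \<alpha>_pos[OF that] by simp
      also have "\<dots> = exp (- \<mu> / 3) * \<beta> a powr s"
        using \<beta>_pos[OF that] by (simp add: z_def powr_def exp_add[symmetric])
      finally show ?thesis .
    qed
    then have "(\<Sum>a<k. d (w @ [a]) * (c a * \<alpha> a)) \<le> (\<Sum>a<k. d (w @ [a]) * (exp (- \<mu> / 3) * \<beta> a powr s))"
      using d0 w by (intro sum_mono mult_left_mono) auto
    also have "\<dots> = exp (- \<mu> / 3) * d w"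
      by (subst d_sum[OF w]) (simp add: sum_distrib_left mult_ac)
    finally have "prod_list (map c w) * (\<Sum>a<k. d (w @ [a]) * (c a * \<alpha> a))
        \<le> prod_list (map c w) * (exp (- \<mu> / 3) * d w)"
      using P by (intro mult_left_mono) auto
    then show ?thesis
      by (simp add: f_def sum_distrib_left mult_ac)
  qed
  ultimately have "\<not> succeeds f R"
    using \<mu> by (intro strict_supermartingale_not_succeeds[of f "exp (- \<mu> / 3)"]) auto
  then obtain B where B: "\<And>n. d (map R [0..<n]) * (\<Prod>i<n. c (R i)) \<le> B"
    unfolding succeeds_iff_unbounded f_def prod_list_map_prefix by (meson not_less)
  have "0 < (\<Sum>a<k. \<alpha> a * ln (c a))"
  proof -
    have "(\<Sum>a<k. \<alpha> a * (z a - \<mu> / 2)) = \<mu> - \<mu> / 2"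
      unfolding sum_\<alpha>_diff by (simp add: \<mu>_def z_def)
    moreover have "(\<Sum>a<k. \<alpha> a * (z a - \<mu> / 2)) \<le> (\<Sum>a<k. \<alpha> a * ln (c a))"
      using c(2) \<alpha>_pos c_pos by (intro sum_mono mult_left_mono) (auto simp: ln_ge_iff less_imp_le)
    ultimately show ?thesis
      using \<mu> by simp
  qed
  then have "filterlim (\<lambda>n. \<Sum>i<n. ln (c (R i))) at_top sequentially"
    by (rule birkhoff_sum_at_top)
  then have "eventually (\<lambda>n. 0 \<le> (\<Sum>i<n. ln (c (R i)))) sequentially"
    by (simp add: filterlim_at_top)
  then obtain N where N: "\<And>n. N \<le> n \<Longrightarrow> 0 \<le> (\<Sum>i<n. ln (c (R i)))"
    by (auto simp: eventually_sequentially)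
  \<comment> \<open>From \<open>N\<close> on the product of the weights is at least 1, so the bound
    on \<open>f\<close> passes to \<open>d\<close>.\<close>
  have le_B: "d (map R [0..<n]) \<le> B" if "N \<le> n" for n
  proof -
    have "1 \<le> (\<Prod>i<n. c (R i))"
      using N[OF that] c_pos R by (simp add: prod_eq_exp_sum_ln)
    then have "d (map R [0..<n]) * 1 \<le> d (map R [0..<n]) * (\<Prod>i<n. c (R i))"
      by (intro mult_left_mono d0 prefix_in_lists R)
    then show ?thesis
      using B[of n] by simp
  qed
  then have "limsup (\<lambda>n. ereal (d (map R [0..<n]))) \<le> ereal B"
    by (intro Limsup_bounded) (auto simp: eventually_sequentially)
  then show False
    using d(3) by (simp add: succeeds_def)
qed

text \<open>\<open>d\<close> is a product of rational weights, hence constructive whatever the real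
  \<open>t\<close> is; \<open>t\<close> enters only through the gale identity. An exponent below
  \<open>s\<close> serves an upper bound on an infimum equally well.\<close>

lemma strongly_succeeding_gale:
  assumes s: "0 \<le> s" and \<mu>: "0 < (\<Sum>a<k. \<alpha> a * (ln (\<alpha> a) - s * ln (\<beta> a)))"
  obtains t d where "0 \<le> t" "t \<le> s" "gale k t \<beta> d" "constructive k d" "succeeds_strongly d R"
proof -
  define \<mu> where "\<mu> = (\<Sum>a<k. \<alpha> a * (ln (\<alpha> a) - s * ln (\<beta> a)))"
  define z where "z a = ln (\<alpha> a) - s * ln (\<beta> a)" for a
  have \<mu>0: "0 < \<mu>"
    using \<mu> by (simp add: \<mu>_def)
  \<comment> \<open>Here \<open>exp (z a)\<close> is \<open>\<alpha> a / \<beta> a powr s\<close>.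
    Staying below it gives \<open>\<psi> s \<le> 1\<close>; staying within \<open>\<mu> / 2\<close>
    on the logarithmic scale keeps the mean of \<open>ln (r a)\<close> positive.\<close>
  obtain r where r: "\<And>a. a < k \<Longrightarrow> r a \<in> \<rat>" "\<And>a. a < k \<Longrightarrow> exp (z a - \<mu> / 2) < r a"
    "\<And>a. a < k \<Longrightarrow> r a < exp (z a)"
    by (rule rational_between_family[of k "\<lambda>a. exp (z a - \<mu> / 2)" "\<lambda>a. exp (z a)"])
        (use \<mu>0 in simp, blast)
  have r_pos: "0 < r a" if "a < k" for a
    using r(2)[OF that] by (meson exp_gt_zero less_trans)
  have ln_r: "0 < (\<Sum>a<k. \<alpha> a * ln (r a))"
  proof -
    have "(\<Sum>a<k. \<alpha> a * (z a - \<mu> / 2)) = \<mu> - \<mu> / 2"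
      unfolding sum_\<alpha>_diff by (simp add: \<mu>_def z_def)
    moreover have "(\<Sum>a<k. \<alpha> a * (z a - \<mu> / 2)) \<le> (\<Sum>a<k. \<alpha> a * ln (r a))"
      using r(2) \<alpha>_pos r_pos by (intro sum_mono mult_left_mono) (auto simp: ln_ge_iff less_imp_le)
    ultimately show ?thesis
      using \<mu>0 by simp
  qed
  \<comment> \<open>The product of the weights is a \<open>t\<close>-\<beta>-gale exactly when
    \<open>\<psi> t = 1\<close>; the intermediate value theorem will supply such a
    \<open>t\<close>.\<close>
  define \<psi> where "\<psi> t = (\<Sum>a<k. r a * exp (t * ln (\<beta> a)))" for t
  have "\<psi> s \<le> (\<Sum>a<k. \<alpha> a)"
    unfolding \<psi>_def
  proof (rule sum_mono)
    fix a assume "a \<in> {..<k}"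
    then have a: "a < k" by simp
    have "r a * exp (s * ln (\<beta> a)) \<le> exp (z a) * exp (s * ln (\<beta> a))"
      using r(3)[OF a] by simp
    also have "\<dots> = \<alpha> a"
      using \<alpha>_pos[OF a] by (simp add: z_def exp_add[symmetric])
    finally show "r a * exp (s * ln (\<beta> a)) \<le> \<alpha> a" .
  qed
  then have "\<psi> s \<le> 1"
    by (simp add: sum_\<alpha>)
  \<comment> \<open>By \<open>ln (r a) \<le> r a - 1\<close> and \<open>\<alpha> a \<le> 1\<close>,
    the positive mean of \<open>ln (r a)\<close> forces the weights to sum to at least 1.\<close>
  moreover have "1 \<le> \<psi> 0"
  proof -
    have "(\<Sum>a<k. \<alpha> a * ln (r a)) \<le> (\<Sum>a<k. \<alpha> a * (r a - 1))"
      using \<alpha>_pos r_pos by (intro sum_mono mult_left_mono ln_le_minus_one) (auto intro: less_imp_le)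
    also have "\<dots> = (\<Sum>a<k. \<alpha> a * r a) - 1"
      by (simp add: right_diff_distrib sum_subtractf sum_\<alpha>)
    also have "(\<Sum>a<k. \<alpha> a * r a) \<le> (\<Sum>a<k. 1 * r a)"
      using prob r_pos by (intro sum_mono mult_right_mono) (auto simp: prob_measure_on_def less_imp_le)
    finally show ?thesis
      using ln_r by (simp add: \<psi>_def)
  qed
  moreover have "continuous_on {0..s} \<psi>"
    unfolding \<psi>_def by (intro continuous_intros)
  ultimately obtain t where t: "0 \<le> t" "t \<le> s" "\<psi> t = 1"
    using IVT2'[of \<psi> s 1 0] s by blast
  define d where "d w = prod_list (map r w)" for w
  have "gale k t \<beta> d"
    unfolding gale_def
  proof (intro ballI conjI)
    fix w assume w: "w \<in> lists {..<k}"
    show "0 \<le> d w"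
      using prod_list_map_pos[OF w] r_pos by (simp add: d_def less_imp_le)
    have "(\<Sum>a<k. d (w @ [a]) * \<beta> a powr t) = d w * \<psi> t"
      unfolding \<psi>_def sum_distrib_left
    proof (intro sum.cong refl)
      fix a assume "a \<in> {..<k}"
      then have "\<beta> a \<noteq> 0"
        using \<beta>_pos[of a] by simp
      then show "d (w @ [a]) * \<beta> a powr t = d w * (r a * exp (t * ln (\<beta> a)))"
        by (simp add: d_def powr_def)
    qed
    then show "d w = (\<Sum>a<k. d (w @ [a]) * \<beta> a powr t)"
      by (simp add: t)
  qed
  moreover have "constructive k d"
    using lower_semicomputable_mult_prod_list[OF lower_semicomputable_const_1, of k r] r(1) r_pos
    by (intro lower_semicomputable_imp_constructive) (simp add: d_def[abs_def] less_imp_le)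
  moreover have "succeeds_strongly d R"
  proof -
    have "filterlim (\<lambda>n. exp (\<Sum>i<n. ln (r (R i)))) at_top sequentially"
      by (rule filterlim_compose[OF exp_at_top birkhoff_sum_at_top[OF ln_r]])
    moreover have "exp (\<Sum>i<n. ln (r (R i))) = d (map R [0..<n])" for n
      unfolding d_def prod_list_map_prefix using r_pos R by (simp add: prod_eq_exp_sum_ln)
    ultimately have "(\<lambda>n. ereal (d (map R [0..<n]))) \<longlonglongrightarrow> \<infinity>"
      by (simp add: tendsto_PInfty_eq_at_top)
    then show ?thesis
      unfolding succeeds_strongly_def by (intro lim_imp_Liminf) auto
  qed
  ultimately show thesis
    using that t by blast
qed

end

end

section \<open>The common value of the two dimensions\<close>

lemma succeeds_strongly_imp_succeeds: "succeeds_strongly d S \<Longrightarrow> succeeds d S"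
  unfolding succeeds_def succeeds_strongly_def
  using Liminf_le_Limsup[of sequentially "\<lambda>n. ereal (d (map S [0..<n]))"] by simp

theorem theorem3p5:
  fixes k :: nat and \<alpha> \<beta> :: "nat \<Rightarrow> real" and R :: "nat \<Rightarrow> nat"
  assumes "2 \<le> k"
    and "prob_measure_on k \<alpha>" and "positive_measure k \<alpha>" and "computable_measure k \<alpha>"
    and "prob_measure_on k \<beta>" and "positive_measure k \<beta>" and "computable_measure k \<beta>"
    and "\<forall>n. R n < k"
    and "random_wrt k \<alpha> R"
  shows "constructive_dim k \<beta> R = constructive_strong_dim k \<beta> R \<and>
    constructive_strong_dim k \<beta> R =
      ereal (shannon_entropy k \<alpha> / (shannon_entropy k \<alpha> + kl_div k \<alpha> \<beta>))"
proof -
  interpret random_sequence k \<alpha> R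
    by unfold_locales (use assms in auto)
  have \<beta>_pos: "0 < \<beta> a" if "a < k" for a
    using assms(6) that by (simp add: positive_measure_def)
  \<comment> \<open>Entropy \<open>H\<close> and cross entropy \<open>C\<close> in natural
    logarithms; entropy plus divergence is the cross entropy, and \<open>ln 2\<close> cancels in the
    quotient.\<close>
  define H where "H = - (\<Sum>a<k. \<alpha> a * ln (\<alpha> a))"
  define C where "C = - (\<Sum>a<k. \<alpha> a * ln (\<beta> a))"
  have entropy: "shannon_entropy k \<alpha> = H / ln 2"
    unfolding shannon_entropy_def H_def sum_negf[symmetric] sum_divide_distrib
    using \<alpha>_pos by (intro sum.cong) (auto simp: log_def ln_div)
  have "shannon_entropy k \<alpha> + kl_div k \<alpha> \<beta> = C / ln 2"
    unfolding shannon_entropy_def kl_div_def C_def sum_negf[symmetric] sum_divide_distrib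
        sum.distrib[symmetric]
  proof (intro sum.cong refl)
    fix a assume "a \<in> {..<k}"
    then have "0 < \<alpha> a" "0 < \<beta> a"
      using \<alpha>_pos \<beta>_pos by simp_all
    then show "\<alpha> a * log 2 (1 / \<alpha> a) + \<alpha> a * log 2 (\<alpha> a / \<beta> a) = - (\<alpha> a * ln (\<beta> a)) / ln 2"
      by (simp add: log_def ln_div field_simps)
  qed
  then have ratio: "shannon_entropy k \<alpha> / (shannon_entropy k \<alpha> + kl_div k \<alpha> \<beta>) = H / C"
    by (simp add: entropy)
  \<comment> \<open>Since \<open>2 \<le> k\<close>, a second symbol takes positive mass. Hence every
    \<open>ln (\<beta> a)\<close> is negative and \<open>C\<close> is positive.\<close>
  have "\<beta> a < 1" if a: "a < k" for a
  proof -
    define b where "b = (if a = 0 then 1 else 0 :: nat)"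
    have b: "b < k" "b \<noteq> a"
      using assms(1) by (auto simp: b_def)
    have "(\<Sum>i\<in>{a, b}. \<beta> i) \<le> (\<Sum>i<k. \<beta> i)"
      using a b \<beta>_pos by (intro sum_mono2) (auto intro: less_imp_le)
    then show ?thesis
      using assms(5) b \<beta>_pos[of b] by (simp add: prob_measure_on_def)
  qed
  then have C: "0 < C"
    unfolding C_def sum_negf[symmetric] using \<alpha>_pos \<beta>_pos assms(1)
    by (intro sum_pos) (auto simp: mult_pos_neg lessThan_empty_iff)
  have H: "0 \<le> H"
    unfolding H_def sum_negf[symmetric] using \<alpha>_pos assms(2)
    by (intro sum_nonneg) (auto simp: prob_measure_on_def mult_nonneg_nonpos less_imp_le)
  \<comment> \<open>The quantity in both gale lemmas thus changes sign at
    \<open>s = H / C\<close>.\<close>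
  have exponent: "(\<Sum>a<k. \<alpha> a * (ln (\<alpha> a) - s * ln (\<beta> a))) = s * C - H" for s
    by (simp add: H_def C_def right_diff_distrib sum_subtractf sum_distrib_left mult_ac)

  have "ereal (H / C) \<le> constructive_dim k \<beta> R"
    unfolding constructive_dim_def
  proof (rule Inf_greatest, clarify)
    fix s d assume "gale k s \<beta> d" "constructive k d" "succeeds d R"
    from gale_succeeds_imp_entropy_le[OF assms(6) this] have "H \<le> s * C"
      unfolding exponent by simp
    then show "ereal (H / C) \<le> ereal s"
      using C by (simp add: pos_divide_le_eq)
  qed
  \<comment> \<open>Strong success implies success, so the infimum on the left ranges over a larger
    set of exponents.\<close>
  moreover have "constructive_dim k \<beta> R \<le> constructive_strong_dim k \<beta> R"
    unfolding constructive_dim_def constructive_strong_dim_def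
    by (rule Inf_superset_mono) (use succeeds_strongly_imp_succeeds in blast)
  moreover have "constructive_strong_dim k \<beta> R \<le> ereal (H / C)"
  proof (rule ereal_le_epsilon2)
    fix e :: real assume e: "0 < e"
    \<comment> \<open>At \<open>s = H / C + e\<close> the sign quantity equals \<open>e * C\<close>,
      which is positive.\<close>
    have "0 \<le> H / C + e" "0 < (H / C + e) * C - H"
      using C H e by (simp_all add: field_simps)
    then obtain t d where t: "0 \<le> t" "t \<le> H / C + e" "gale k t \<beta> d" "constructive k d"
        "succeeds_strongly d R"
      by (rule strongly_succeeding_gale[OF assms(6), where s = "H / C + e", unfolded exponent])
    then have "constructive_strong_dim k \<beta> R \<le> ereal t"
      unfolding constructive_strong_dim_def by (intro Inf_lower) blast
    also have "\<dots> \<le> ereal (H / C) + ereal e"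
      using t(2) by simp
    finally show "constructive_strong_dim k \<beta> R \<le> ereal (H / C) + ereal e" .
  qed
  ultimately show ?thesis
    unfolding ratio by (simp add: antisym)
qed

end
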